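(* It holds that $$\operatorname{Pf}\left(\frac{y_i-y_j}{a+b(x_i+x_j)+cx_ix_j}\right)_{1\le i,j\le 2n}\times\prod_{1\le i<j\le 2n}\{a+b(x_i+x_j)+cx_ix_j\}$$ $$=(ac-b^2)^{\binom n2}\sum_{\substack{I\subseteq[2n]\\ \sharp I=n}}(-1)^{|I|-\binom{n+1}2}\,y_I\,\Delta_I(x)\Delta_{\overline I}(x)J_I(x)J_{\overline I}(x)$$ $$=(ac-b^2)^{\binom n2}\sum_{\substack{I\subseteq[2n]\\ \sharp I=n,\ i_1<j_1}}(-1)^{|I|-\binom{n+1}2}\bigl(y_I+(-1)^ny_{\overline I}\bigr)\Delta_I(x)\Delta_{\overline I}(x)J_I(x)J_{\overline I}(x),$$ where the first sum runs over all $n$-element subsets $I=\{i_1<\cdots<i_n\}$ of $[2n]$, the second over those with $i_1<j_1$, and $\overline I=\{j_1<\cdots<j_n\}$ is the complementary subset of $I$ in $[2n]$. In particular, if the relation $ac=b^2$ holds, then $$\operatorname{Pf}\left(\frac{y_i-y_j}{a+b(x_i+x_j)+cx_ix_j}\right)_{1\le i,j\le 2n}=0.$$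
   Context: Here $n$ is a positive integer, $x_1,\dots,x_{2n},y_1,\dots,y_{2n},a,b,c$ are commuting variables, $[2n]=\{1,2,\dots,2n\}$, and $|I|=i_1+\cdots+i_n$. For $I\subseteq[2n]$: $\Delta_I(x)=\prod_{i,j\in I,\,i<j}(x_i-x_j)$, $J_I(x)=J_I(x;a,b,c)=\prod_{i,j\in I,\,i<j}\{a+b(x_i+x_j)+cx_ix_j\}$, and $y_I=\prod_{i\in I}y_i$. $\operatorname{Pf}$ denotes the Pfaffian of a skew-symmetric matrix of even size, normalized by $\operatorname{Pf}\begin{pmatrix}0&u\\-u&0\end{pmatrix}=u$.
   Formalization: The final clause (Pf = 0 when ac = b^2) is stated only for n ≥ 2; for n = 1 it is false, since Pf = (y_1−y_2)/(a+b(x_1+x_2)+c x_1x_2), which is y_1−y_2 when a = 1, b = c = 0. *)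

theory Defs
  imports Complex_Main "HOL-Combinatorics.Permutations"
begin

text \<open>
  A perfect matching of \<open>{1..2n}\<close> is encoded by the unique permutation \<open>\<sigma>\<close> that lists its
  pairs \<open>\<sigma>(1) < \<sigma>(2)\<close>, ..., \<open>\<sigma>(2n-1) < \<sigma>(2n)\<close> by increasing first elements.
\<close>

definition matching_perms :: "nat \<Rightarrow> (nat \<Rightarrow> nat) set" where
  "matching_perms n = {\<sigma>. \<sigma> permutes {1..2*n}
     \<and> (\<forall>k\<in>{1..n}. \<sigma> (2*k - 1) < \<sigma> (2*k))
     \<and> (\<forall>k\<in>{1..<n}. \<sigma> (2*k - 1) < \<sigma> (2*k + 1))}"

text \<open>
  The Pfaffian of the skew-symmetric matrix \<open>(A i j)\<close> with \<open>1 \<le> i, j \<le> 2n\<close>. Only the entries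
  above the diagonal are used, and no division occurs, so that the definition makes sense in any
  characteristic.
\<close>

definition pfaffian :: "nat \<Rightarrow> (nat \<Rightarrow> nat \<Rightarrow> 'a::comm_ring_1) \<Rightarrow> 'a" where
  "pfaffian n A =
     (\<Sum>\<sigma>\<in>matching_perms n. of_int (sign \<sigma>) * (\<Prod>k=1..n. A (\<sigma> (2*k - 1)) (\<sigma> (2*k))))"

lemma pfaffian_1: "pfaffian 1 A = A 1 2"
proof -
  have set12: "{1..2*1} = {1, 2::nat}"
    by auto
  have "matching_perms 1 = {id}"
  proof (intro equalityI subsetI)
    fix \<sigma> assume "\<sigma> \<in> matching_perms 1"
    then have p: "\<sigma> permutes {1, 2}" and less: "\<sigma> 1 < \<sigma> 2"
      unfolding matching_perms_def set12 by auto
    have "\<sigma> 1 \<in> {1, 2}" "\<sigma> 2 \<in> {1, 2}"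
      using permutes_in_image[OF p] by auto
    with less have "\<sigma> 1 = 1" "\<sigma> 2 = 2"
      by auto
    moreover have "\<sigma> k = k" if "k \<notin> {1, 2}" for k
      using permutes_not_in[OF p that] .
    ultimately have "\<sigma> = id"
      by (metis eq_id_iff insertE singletonD)
    then show "\<sigma> \<in> {id}"
      by simp
  qed (auto simp: matching_perms_def permutes_id)
  then show ?thesis
    by (simp add: pfaffian_def sign_id numeral_2_eq_2)
qed

definition Delta :: "(nat \<Rightarrow> 'a::comm_ring_1) \<Rightarrow> nat set \<Rightarrow> 'a" where
  "Delta x I = (\<Prod>(i, j)\<in>{(i, j). i \<in> I \<and> j \<in> I \<and> i < j}. x i - x j)"

definition J :: "'a::comm_ring_1 \<Rightarrow> 'a \<Rightarrow> 'a \<Rightarrow> (nat \<Rightarrow> 'a) \<Rightarrow> nat set \<Rightarrow> 'a" where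
  "J a b c x I =
     (\<Prod>(i, j)\<in>{(i, j). i \<in> I \<and> j \<in> I \<and> i < j}. a + b * (x i + x j) + c * x i * x j)"

text \<open>
  The summand for \<open>I\<close> without its factor in \<open>y\<close>. The truncated subtraction in the exponent is
  exact for all \<open>n\<close>-element subsets \<open>I\<close> of \<open>{1..2n}\<close>, since then \<open>\<Sum>I \<ge> 1 + \<cdots> + n\<close>.
\<close>

definition subset_weight ::
    "nat \<Rightarrow> 'a::comm_ring_1 \<Rightarrow> 'a \<Rightarrow> 'a \<Rightarrow> (nat \<Rightarrow> 'a) \<Rightarrow> nat set \<Rightarrow> 'a" where
  "subset_weight n a b c x I =
     (- 1) ^ (\<Sum>I - ((n + 1) choose 2))
       * Delta x I * Delta x ({1..2*n} - I) * J a b c x I * J a b c x ({1..2*n} - I)"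

end

theory Submission
  imports Defs "Jordan_Normal_Form.Determinant"
begin

text \<open>
  Expanding \<open>\<Prod>(y\<^sub>i - y\<^sub>j)\<close> over a perfect matching chooses one endpoint of every edge, so every
  monomial of the Pfaffian is \<open>y\<^sub>I\<close> for a set \<open>I\<close> of \<open>n\<close> indices, and the matchings contributing
  to it are the bijections from \<open>I\<close> to its complement. Its coefficient is therefore, up to sign,
  the determinant of the matrix with entries \<open>1 / (a + b (x\<^sub>i + x\<^sub>j) + c x\<^sub>i x\<^sub>j)\<close> for \<open>i \<in> I\<close>,
  \<open>j \<notin> I\<close>. This is a Cauchy determinant: one pivot step multiplies each entry by a factor
  \<open>r\<^sub>i s\<^sub>j\<close>, since the relevant \<open>2 \<times> 2\<close> minors of \<open>a + b (u + v) + c u v\<close> are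
  \<open>(b\<^sup>2 - ac)(u - u')(v - v')\<close>. The folded sum pairs \<open>I\<close> with its complement.
\<close>

section \<open>A Cauchy determinant\<close>

text \<open>Most of the work is the sign. It has to survive three rearrangements of a list of edges:
  reversing an edge, which negates the sign of the permutation just as the chosen term
  \<open>- y j\<close> requires; reordering whole edges, which is even; and replacing the bijection
  from \<open>I\<close> to its complement by the reference one that joins elements of equal rank,
  which costs the sign of a permutation \<open>p\<close> and is exactly the Leibniz sign of the
  determinant. What is left is the sign of the reference list, with exponent
  \<open>\<Sum>I + n\<close>. The Cauchy determinant brings a power of
  \<open>b\<^sup>2 - a * c\<close>; turning it into a power of \<open>a * c - b\<^sup>2\<close> adds
  \<open>n choose 2\<close> to that exponent, and \<open>n + (n choose 2)\<close> is the offset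
  \<open>n + 1 choose 2\<close> of the theorem. The pivots of the determinant are reciprocals and
  hence nonzero, so the argument is uniform in the \<open>x i\<close> and covers
  \<open>a * c = b\<^sup>2\<close>.\<close>

lemma det_pivot_last:
  fixes f :: "nat \<Rightarrow> nat \<Rightarrow> 'a::field"
  assumes "f n n \<noteq> 0"
  shows "det (mat (Suc n) (Suc n) (\<lambda>(i, j). f i j))
    = f n n * det (mat n n (\<lambda>(i, j). f i j - f i n * f n j / f n n))"
proof -
  define M where "M = mat (Suc n) (Suc n) (\<lambda>(i, j). f i j)"
  \<comment> \<open>Left multiplication by the unitriangular \<open>L\<close> subtracts from each
    row \<open>i < n\<close> the multiple of row \<open>n\<close> that clears column
    \<open>n\<close>; the remaining block is the Schur complement of the pivot.\<close>
  define L where "L = mat (Suc n) (Suc n)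
    (\<lambda>(i, j). if i = j then 1 else if j = n then - f i n / f n n else 0)"
  define N where "N = mat (Suc n) (Suc n)
    (\<lambda>(i, j). if i = n then f n j else f i j - f i n * f n j / f n n)"
  have carrier: "M \<in> carrier_mat (Suc n) (Suc n)" "L \<in> carrier_mat (Suc n) (Suc n)"
      "N \<in> carrier_mat (Suc n) (Suc n)"
    by (auto simp: M_def L_def N_def)
  have "upper_triangular L"
    by (auto simp: L_def upper_triangular_def)
  then have "det L = prod_list (diag_mat L)"
    using carrier(2) by (rule det_upper_triangular)
  also have "diag_mat L = map (\<lambda>i. 1) [0..<Suc n]"
    unfolding diag_mat_def by (rule map_cong) (auto simp: L_def)
  finally have "det L = 1"
    by (simp add: map_replicate_const del: upt_Suc)
  moreover have "L * M = N"
  proof (rule eq_matI)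
    fix i j assume "i < dim_row N" "j < dim_col N"
    then have ij: "i < Suc n" "j < Suc n"
      by (auto simp: N_def)
    have "(L * M) $$ (i, j) = (\<Sum>k = 0..<Suc n. L $$ (i, k) * M $$ (k, j))"
      using ij carrier by (simp add: scalar_prod_def)
    also have "\<dots> = (\<Sum>k<n. if k = i then f i j else 0)
        + (if i = n then 1 else - f i n / f n n) * f n j"
      using ij unfolding lessThan_atLeast0[symmetric] sum.lessThan_Suc
      by (intro arg_cong2[where f = "(+)"] sum.cong) (auto simp: L_def M_def)
    also have "\<dots> = N $$ (i, j)"
      using ij by (auto simp: N_def)
    finally show "(L * M) $$ (i, j) = N $$ (i, j)" .
  qed (auto simp: L_def M_def N_def)
  ultimately have "det M = det N"
    using det_mult[OF carrier(2,1)] by simp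
  also have "\<dots> = (\<Sum>i<Suc n. N $$ (i, n) * cofactor N i n)"
    using carrier(3) by (rule laplace_expansion_column) simp
  also have "\<dots> = (\<Sum>i<n. 0) + f n n * cofactor N n n"
    unfolding sum.lessThan_Suc
    by (intro arg_cong2[where f = "(+)"] sum.cong) (auto simp: N_def assms)
  also have "mat_delete N n n = mat n n (\<lambda>(i, j). f i j - f i n * f n j / f n n)"
    by (rule eq_matI) (auto simp: mat_delete_def N_def)
  then have "cofactor N n n = det (mat n n (\<lambda>(i, j). f i j - f i n * f n j / f n n))"
    by (simp add: cofactor_def)
  finally show ?thesis
    by (simp add: M_def)
qed

lemma det_mat_leibniz:
  "det (mat n n (\<lambda>(i, j). f i j))
    = (\<Sum>p | p permutes {..<n}. signof p * (\<Prod>i<n. f i (p i)))"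
proof -
  have "det (mat n n (\<lambda>(i, j). f i j))
      = (\<Sum>p | p permutes {..<n}. signof p * (\<Prod>i<n. mat n n (\<lambda>(i, j). f i j) $$ (i, p i)))"
    by (simp only: det_def'[OF mat_carrier] lessThan_atLeast0)
  also have "\<dots> = (\<Sum>p | p permutes {..<n}. signof p * (\<Prod>i<n. f i (p i)))"
  proof (rule sum.cong)
    fix p assume "p \<in> {p. p permutes {..<n}}"
    then have "p i < n" if "i < n" for i
      using that permutes_in_image[of p "{..<n}" i] by simp
    then show "signof p * (\<Prod>i<n. mat n n (\<lambda>(i, j). f i j) $$ (i, p i))
        = signof p * (\<Prod>i<n. f i (p i))"
      by simp
  qed simp
  finally show ?thesis .
qed

lemma det_mat_scale:
  fixes f :: "nat \<Rightarrow> nat \<Rightarrow> 'a::comm_ring_1"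
  shows "det (mat n n (\<lambda>(i, j). r i * s j * f i j))
    = (\<Prod>i<n. r i) * (\<Prod>j<n. s j) * det (mat n n (\<lambda>(i, j). f i j))"
  unfolding det_mat_leibniz sum_distrib_left
proof (rule sum.cong)
  fix p assume "p \<in> {p. p permutes {..<n}}"
  then have "(\<Prod>i<n. s (p i)) = (\<Prod>j<n. s j)"
    using prod.permute[of p "{..<n}" s] by (simp add: o_def)
  then show "signof p * (\<Prod>i<n. r i * s (p i) * f i (p i))
      = (\<Prod>i<n. r i) * (\<Prod>j<n. s j) * (signof p * (\<Prod>i<n. f i (p i)))"
    by (simp add: prod.distrib algebra_simps)
qed simp

definition bilin :: "'a::comm_ring_1 \<Rightarrow> 'a \<Rightarrow> 'a \<Rightarrow> 'a \<Rightarrow> 'a \<Rightarrow> 'a" where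
  "bilin a b c u v = a + b * (u + v) + c * u * v"

lemma bilin_commute: "bilin a b c u v = bilin a b c v u"
  by (simp add: bilin_def algebra_simps)

text \<open>\<open>bilin a b c u v\<close> is the row \<open>(1, u)\<close> times the symmetric
  matrix with rows \<open>(a, b)\<close> and \<open>(b, c)\<close> times the column
  \<open>(1, v)\<close>. A 2 by 2 minor is therefore a product of three determinants, the middle one
  being \<open>a * c - b\<^sup>2\<close>.\<close>

lemma bilin_exchange:
  "bilin a b c u v' * bilin a b c u' v - bilin a b c u' v' * bilin a b c u v
    = (b\<^sup>2 - a * c) * (u - u') * (v - v')"
  by (simp add: bilin_def algebra_simps power2_eq_square)

text \<open>Induction with the entry \<open>1 / B n n\<close> as pivot. It is nonzero even when both
  sides vanish, so coinciding points and \<open>b\<^sup>2 = a * c\<close> are treated like all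
  others.\<close>

lemma det_cauchy_bilin:
  fixes u v :: "nat \<Rightarrow> 'a::field"
  assumes "\<And>i j. i < n \<Longrightarrow> j < n \<Longrightarrow> bilin a b c (u i) (v j) \<noteq> 0"
  shows "det (mat n n (\<lambda>(i, j). 1 / bilin a b c (u i) (v j)))
      * (\<Prod>i<n. \<Prod>j<n. bilin a b c (u i) (v j))
    = (b\<^sup>2 - a * c) ^ (n choose 2)
      * (\<Prod>q<n. \<Prod>p<q. u p - u q) * (\<Prod>q<n. \<Prod>p<q. v p - v q)"
  using assms
proof (induction n)
  case 0
  then show ?case by (simp add: numeral_2_eq_2)
next
  case (Suc n)
  define B where "B i j = bilin a b c (u i) (v j)" for i j
  define d where "d = b\<^sup>2 - a * c"
  \<comment> \<open>The factor \<open>d\<close> of each reduced entry is assigned to its row, so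
    that the \<open>n\<close> rows supply \<open>d ^ n\<close>, the growth of the exponent from
    \<open>n choose 2\<close> to \<open>Suc n choose 2\<close>.\<close>
  define R where "R i = d * (u i - u n) / B i n" for i
  define S where "S j = (v j - v n) / B n j" for j
  have nz: "B i j \<noteq> 0" if "i \<le> n" "j \<le> n" for i j
    using Suc.prems that by (simp add: B_def less_Suc_eq_le)
  have entry: "1 / B i j - (1 / B i n) * (1 / B n j) / (1 / B n n) = R i * S j * (1 / B i j)"
    if "i < n" "j < n" for i j
  proof -
    have "1 / B i j - (1 / B i n) * (1 / B n j) / (1 / B n n)
        = (B i n * B n j - B n n * B i j) / (B i n * B n j * B i j)"
      using nz[of i n] nz[of n j] nz[of i j] nz[of n n] that by (simp add: field_simps)
    also have "B i n * B n j - B n n * B i j = d * (u i - u n) * (v j - v n)"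
      unfolding B_def d_def by (rule bilin_exchange)
    finally show ?thesis
      by (simp add: R_def S_def)
  qed
  have "det (mat (Suc n) (Suc n) (\<lambda>(i, j). 1 / B i j))
      = 1 / B n n * det (mat n n (\<lambda>(i, j). 1 / B i j - (1 / B i n) * (1 / B n j) / (1 / B n n)))"
    by (rule det_pivot_last) (use nz[of n n] in simp)
  also have "mat n n (\<lambda>(i, j). 1 / B i j - (1 / B i n) * (1 / B n j) / (1 / B n n))
      = mat n n (\<lambda>(i, j). R i * S j * (1 / B i j))"
    by (rule cong_mat) (simp_all only: prod.case entry)
  also have "det \<dots> = (\<Prod>i<n. R i) * (\<Prod>j<n. S j) * det (mat n n (\<lambda>(i, j). 1 / B i j))"
    by (rule det_mat_scale)
  finally have step: "det (mat (Suc n) (Suc n) (\<lambda>(i, j). 1 / B i j))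
      = 1 / B n n * ((\<Prod>i<n. R i) * (\<Prod>j<n. S j) * det (mat n n (\<lambda>(i, j). 1 / B i j)))" .
  have R: "(\<Prod>i<n. R i) * (\<Prod>i<n. B i n) = d ^ n * (\<Prod>i<n. u i - u n)"
  proof -
    have "(\<Prod>i<n. R i) * (\<Prod>i<n. B i n) = (\<Prod>i<n. d * (u i - u n))"
      unfolding prod.distrib[symmetric] by (rule prod.cong) (simp_all add: R_def nz)
    then show ?thesis by (simp add: prod.distrib)
  qed
  have S: "(\<Prod>j<n. S j) * (\<Prod>j<n. B n j) = (\<Prod>j<n. v j - v n)"
    unfolding prod.distrib[symmetric] by (rule prod.cong) (simp_all add: S_def nz)
  have all: "(\<Prod>i<Suc n. \<Prod>j<Suc n. B i j)
      = (\<Prod>i<n. \<Prod>j<n. B i j) * (\<Prod>i<n. B i n) * (\<Prod>j<n. B n j) * B n n"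
    by (simp add: prod.distrib mult_ac)
  have IH: "det (mat n n (\<lambda>(i, j). 1 / B i j)) * (\<Prod>i<n. \<Prod>j<n. B i j)
      = d ^ (n choose 2) * (\<Prod>q<n. \<Prod>p<q. u p - u q) * (\<Prod>q<n. \<Prod>p<q. v p - v q)"
    unfolding B_def d_def by (rule Suc.IH) (use Suc.prems in auto)
  have choose: "Suc n choose 2 = n + (n choose 2)"
    by (simp add: numeral_2_eq_2)
  have "det (mat (Suc n) (Suc n) (\<lambda>(i, j). 1 / B i j)) * (\<Prod>i<Suc n. \<Prod>j<Suc n. B i j)
      = ((\<Prod>i<n. R i) * (\<Prod>i<n. B i n)) * ((\<Prod>j<n. S j) * (\<Prod>j<n. B n j))
        * (det (mat n n (\<lambda>(i, j). 1 / B i j)) * (\<Prod>i<n. \<Prod>j<n. B i j))"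
    unfolding step all using nz[of n n] by (simp add: mult_ac)
  also have "\<dots> = d ^ (Suc n choose 2)
      * (\<Prod>q<Suc n. \<Prod>p<q. u p - u q) * (\<Prod>q<Suc n. \<Prod>p<q. v p - v q)"
    unfolding R S IH choose power_add by (simp add: mult_ac)
  finally show ?case
    by (simp add: B_def d_def)
qed

section \<open>Increasing enumerations and sorting\<close>

definition enum :: "nat set \<Rightarrow> nat \<Rightarrow> nat" where
  "enum S k = sorted_list_of_set S ! k"

lemma strict_mono_on_enum: "strict_mono_on {..<card S} (enum S)"
proof (rule strict_mono_onI)
  fix i j assume "j \<in> {..<card S}" "i < j"
  then show "enum S i < enum S j"
    unfolding enum_def
    by (intro sorted_wrt_nth_less[OF strict_sorted_list_of_set]) auto
qed

lemma bij_betw_enum: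
  assumes "finite S"
  shows "bij_betw (enum S) {..<card S} S"
proof -
  have "bij_betw ((!) (sorted_list_of_set S)) {..<length (sorted_list_of_set S)} (set (sorted_list_of_set S))"
    by (rule bij_betw_nth) auto
  then show ?thesis
    using assms by (simp add: enum_def[abs_def])
qed

lemma enum_unique:
  assumes "strict_mono_on {..<n} f" "k < n"
  shows "enum (f ` {..<n}) k = f k"
proof -
  have "inj_on f {..<n}"
    using assms(1) by (rule strict_mono_on_imp_inj_on)
  then have "card (f ` {..<n}) = n"
    by (simp add: card_image)
  moreover have "sorted_wrt (<) (map f [0..<n])"
    using assms(1) by (auto simp: sorted_wrt_iff_nth_less strict_mono_on_def)
  ultimately have "sorted_list_of_set (f ` {..<n}) = map f [0..<n]"
    by (subst sorted_list_of_set_unique[symmetric]) (auto simp: lessThan_atLeast0)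
  then show ?thesis
    using assms(2) by (simp add: enum_def)
qed

text \<open>Both composites are the increasing enumeration of the same image of \<open>key\<close>,
  and an injective key can be cancelled.\<close>

lemma sorting_permutation_unique:
  fixes key :: "nat \<Rightarrow> nat"
  assumes "inj_on key {..<n}" "p permutes {..<n}" "q permutes {..<n}"
    "strict_mono_on {..<n} (key \<circ> p)" "strict_mono_on {..<n} (key \<circ> q)"
  shows "p = q"
proof
  fix k
  show "p k = q k"
  proof (cases "k < n")
    case True
    have "(key \<circ> p) ` {..<n} = key ` {..<n}" "(key \<circ> q) ` {..<n} = key ` {..<n}"
      using assms(2,3) by (simp_all only: image_comp[symmetric] permutes_image)
    then have "(key \<circ> p) k = enum (key ` {..<n}) k" "(key \<circ> q) k = enum (key ` {..<n}) k"
      using enum_unique[OF assms(4) True] enum_unique[OF assms(5) True] by simp_all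
    moreover have "p k \<in> {..<n}" "q k \<in> {..<n}"
      using True permutes_in_image[OF assms(2)] permutes_in_image[OF assms(3)] by auto
    ultimately show ?thesis
      using inj_onD[OF assms(1), of "p k" "q k"] by simp
  next
    case False
    then show ?thesis
      using assms(2,3) by (simp add: permutes_not_in)
  qed
qed

lemma sorting_permutation_exists:
  fixes key :: "nat \<Rightarrow> nat"
  assumes "inj_on key {..<n}"
  obtains p where "p permutes {..<n}" "strict_mono_on {..<n} (key \<circ> p)"
proof -
  let ?S = "key ` {..<n}"
  let ?i = "inv_into {..<n} key"
  define p where "p k = (if k < n then ?i (enum ?S k) else k)" for k
  have card: "card ?S = n"
    using assms by (simp add: card_image)
  have enum: "bij_betw (enum ?S) {..<n} ?S"
    using bij_betw_enum[of ?S] card by simp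
  have "bij_betw (?i \<circ> enum ?S) {..<n} {..<n}"
    by (rule bij_betw_trans[OF enum]) (rule bij_betw_inv_into[OF inj_on_imp_bij_betw[OF assms]])
  also have "?this \<longleftrightarrow> bij_betw p {..<n} {..<n}"
    by (rule bij_betw_cong) (simp add: p_def)
  finally have "p permutes {..<n}"
    by (rule bij_imp_permutes) (simp add: p_def)
  moreover have "(key \<circ> p) k = enum ?S k" if "k < n" for k
    using that bij_betwE[OF enum] by (simp add: p_def f_inv_into_f)
  then have "strict_mono_on {..<n} (key \<circ> p)"
    using strict_mono_on_enum[of ?S] by (simp add: card strict_mono_on_def)
  ultimately show ?thesis
    by (rule that)
qed

lemma strict_mono_on_lessThan_SucI:
  fixes f :: "nat \<Rightarrow> nat"
  assumes "\<And>k. Suc k < n \<Longrightarrow> f k < f (Suc k)"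
  shows "strict_mono_on {..<n} f"
proof (rule strict_mono_onI)
  fix i j assume "j \<in> {..<n}" "i < j"
  then show "f i < f j"
  proof (induction j)
    case (Suc j)
    with assms[of j] show ?case
      by (cases "i = j") auto
  qed simp
qed

section \<open>Permutations of pairs of positions\<close>

text \<open>
  From here on the \<open>n\<close> edges of a matching are numbered by \<open>k < n\<close>, the \<open>k\<close>-th one occupying the
  positions \<open>2k + 1\<close> and \<open>2k + 2\<close>.
\<close>

lemma position_cases:
  assumes "m \<in> {1..2*n}"
  obtains k where "k < n" "m = Suc (2 * k)" | k where "k < n" "m = Suc (Suc (2 * k))"
proof (cases "even m")
  case True
  with assms have "(m - 2) div 2 < n" "m = Suc (Suc (2 * ((m - 2) div 2)))"
    by auto
  then show ?thesis by (rule that(2))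
next
  case False
  with assms have "m div 2 < n" "m = Suc (2 * (m div 2))"
    by (auto elim!: oddE)
  then show ?thesis by (rule that(1))
qed

lemma permutes_positions_eqI:
  assumes "p permutes {1..2*n}" "q permutes {1..2*n}"
    "\<And>k. k < n \<Longrightarrow> p (Suc (2 * k)) = q (Suc (2 * k))"
    "\<And>k. k < n \<Longrightarrow> p (Suc (Suc (2 * k))) = q (Suc (Suc (2 * k)))"
  shows "p = q"
proof
  fix m
  show "p m = q m"
  proof (cases "m \<in> {1..2*n}")
    case True
    then show ?thesis
      using assms(3,4) by (cases m rule: position_cases) auto
  next
    case False
    then show ?thesis
      using permutes_not_in[OF assms(1)] permutes_not_in[OF assms(2)] by simp
  qed
qed

definition odd_perm :: "nat \<Rightarrow> (nat \<Rightarrow> nat) \<Rightarrow> nat \<Rightarrow> nat" where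
  "odd_perm n p = map_permutation {..<n} (\<lambda>k. Suc (2 * k)) p"

text \<open>On its own this keeps all first endpoints and redistributes the second ones, which is
  how a bijection from a subset to its complement enters; together with \<open>odd_perm\<close> it
  moves whole edges.\<close>

definition even_perm :: "nat \<Rightarrow> (nat \<Rightarrow> nat) \<Rightarrow> nat \<Rightarrow> nat" where
  "even_perm n p = map_permutation {..<n} (\<lambda>k. Suc (Suc (2 * k))) p"

definition pair_perm :: "nat \<Rightarrow> (nat \<Rightarrow> nat) \<Rightarrow> nat \<Rightarrow> nat" where
  "pair_perm n p = odd_perm n p \<circ> even_perm n p"

lemma odd_perm_permutes: "p permutes {..<n} \<Longrightarrow> odd_perm n p permutes (\<lambda>k. Suc (2 * k)) ` {..<n}"
  unfolding odd_perm_def by (rule map_permutation_permutes) (auto simp: bij_betw_def inj_on_def)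

lemma even_perm_permutes: "p permutes {..<n} \<Longrightarrow> even_perm n p permutes (\<lambda>k. Suc (Suc (2 * k))) ` {..<n}"
  unfolding even_perm_def by (rule map_permutation_permutes) (auto simp: bij_betw_def inj_on_def)

lemma even_perm_permutes': "p permutes {..<n} \<Longrightarrow> even_perm n p permutes {1..2*n}"
  by (rule permutes_subset[OF even_perm_permutes]) auto

lemma odd_perm_permutes': "p permutes {..<n} \<Longrightarrow> odd_perm n p permutes {1..2*n}"
  by (rule permutes_subset[OF odd_perm_permutes]) auto

lemma even_perm_apply:
  assumes "p permutes {..<n}"
  shows "even_perm n p (Suc (2 * k)) = Suc (2 * k)"
    and "k < n \<Longrightarrow> even_perm n p (Suc (Suc (2 * k))) = Suc (Suc (2 * p k))"
proof -
  show "even_perm n p (Suc (2 * k)) = Suc (2 * k)"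
    by (rule permutes_not_in[OF even_perm_permutes[OF assms]])
      (auto simp: Suc_double_not_eq_double double_not_eq_Suc_double)
  show "even_perm n p (Suc (Suc (2 * k))) = Suc (Suc (2 * p k))" if "k < n"
    unfolding even_perm_def
    by (rule map_permutation_apply) (use that in \<open>auto simp: inj_on_def\<close>)
qed

lemma odd_perm_apply:
  assumes "p permutes {..<n}"
  shows "odd_perm n p (Suc (Suc (2 * k))) = Suc (Suc (2 * k))"
    and "k < n \<Longrightarrow> odd_perm n p (Suc (2 * k)) = Suc (2 * p k)"
proof -
  show "odd_perm n p (Suc (Suc (2 * k))) = Suc (Suc (2 * k))"
    by (rule permutes_not_in[OF odd_perm_permutes[OF assms]])
      (auto simp: Suc_double_not_eq_double double_not_eq_Suc_double)
  show "odd_perm n p (Suc (2 * k)) = Suc (2 * p k)" if "k < n"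
    unfolding odd_perm_def
    by (rule map_permutation_apply) (use that in \<open>auto simp: inj_on_def\<close>)
qed

lemma pair_perm_apply:
  assumes "p permutes {..<n}" "k < n"
  shows "pair_perm n p (Suc (2 * k)) = Suc (2 * p k)"
    and "pair_perm n p (Suc (Suc (2 * k))) = Suc (Suc (2 * p k))"
  using assms by (simp_all add: pair_perm_def odd_perm_apply even_perm_apply)

lemma pair_perm_permutes: "p permutes {..<n} \<Longrightarrow> pair_perm n p permutes {1..2*n}"
  unfolding pair_perm_def by (intro permutes_compose even_perm_permutes' odd_perm_permutes')

lemma sign_even_perm: "p permutes {..<n} \<Longrightarrow> sign (even_perm n p) = sign p"
  unfolding even_perm_def by (rule sign_map_permutation) (auto simp: inj_on_def)

lemma sign_odd_perm: "p permutes {..<n} \<Longrightarrow> sign (odd_perm n p) = sign p"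
  unfolding odd_perm_def by (rule sign_map_permutation) (auto simp: inj_on_def)

lemma sign_compose_permutes:
  assumes "p permutes A" "q permutes A" "finite A"
  shows "sign (p \<circ> q) = sign p * sign q"
  using assms by (intro sign_compose) (auto simp: permutation_permutes)

text \<open>The odd and the even positions contribute one factor \<open>sign p\<close> each, and the
  square of a sign is 1.\<close>

lemma sign_pair_perm:
  assumes "p permutes {..<n}"
  shows "sign (pair_perm n p) = 1"
  unfolding pair_perm_def
  using assms sign_compose_permutes[OF odd_perm_permutes' even_perm_permutes', of p n p]
  by (simp add: sign_even_perm sign_odd_perm)

lemma pair_perm_compose:
  assumes "p permutes {..<n}" "q permutes {..<n}"
  shows "pair_perm n p \<circ> pair_perm n q = pair_perm n (p \<circ> q)"
proof (rule permutes_positions_eqI[where n = n])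
  show "pair_perm n p \<circ> pair_perm n q permutes {1..2*n}" "pair_perm n (p \<circ> q) permutes {1..2*n}"
    using assms by (intro permutes_compose pair_perm_permutes; simp)+
  fix k assume "k < n"
  moreover from this have "q k < n"
    using assms(2) permutes_in_image[of q "{..<n}" k] by simp
  ultimately show "(pair_perm n p \<circ> pair_perm n q) (Suc (2 * k)) = pair_perm n (p \<circ> q) (Suc (2 * k))"
    "(pair_perm n p \<circ> pair_perm n q) (Suc (Suc (2 * k))) = pair_perm n (p \<circ> q) (Suc (Suc (2 * k)))"
    using assms permutes_compose[OF assms(2,1)] by (simp_all add: pair_perm_apply)
qed

lemma pair_perm_id: "pair_perm n id = id"
  by (rule permutes_positions_eqI[where n = n])
    (simp_all only: pair_perm_permutes permutes_id pair_perm_apply id_apply)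

section \<open>Reversing the edges of a matching\<close>

text \<open>\<open>C\<close> stands for the set of edges \<open>(i, j)\<close> from which
  \<open>- y j\<close> is chosen when the product of the \<open>y i - y j\<close> is expanded;
  \<open>(m - 1) div 2\<close> is the edge at position \<open>m\<close>.\<close>

definition flip :: "nat set \<Rightarrow> nat \<Rightarrow> nat" where
  "flip C m = (if m \<noteq> 0 \<and> (m - 1) div 2 \<in> C then if odd m then Suc m else m - 1 else m)"

lemma flip_apply:
  "flip C (Suc (2 * k)) = (if k \<in> C then Suc (Suc (2 * k)) else Suc (2 * k))"
  "flip C (Suc (Suc (2 * k))) = (if k \<in> C then Suc (2 * k) else Suc (Suc (2 * k)))"
  by (simp_all add: flip_def)

lemma flip_empty: "flip {} = id"
  by (auto simp: flip_def)

lemma flip_insert: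
  assumes "k \<notin> C"
  shows "flip (insert k C) = transpose (Suc (2 * k)) (Suc (Suc (2 * k))) \<circ> flip C"
proof
  fix m
  show "flip (insert k C) m = (transpose (Suc (2 * k)) (Suc (Suc (2 * k))) \<circ> flip C) m"
  proof (cases "m = 0")
    case True
    then show ?thesis by (simp add: flip_def transpose_def)
  next
    case False
    \<comment> \<open>\<open>flip\<close> carries no size parameter, so the bound that
      \<open>position_cases\<close> asks for is taken from \<open>m\<close> itself.\<close>
    then have "m \<in> {1..2 * m}" by simp
    then show ?thesis
      using assms by (cases m rule: position_cases) (auto simp: flip_apply transpose_def)
  qed
qed

lemma flip_involution: "flip C \<circ> flip C = id"
proof
  fix m
  show "(flip C \<circ> flip C) m = id m"
  proof (cases "m = 0")
    case True
    then show ?thesis by (simp add: flip_def)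
  next
    case False
    then have "m \<in> {1..2 * m}" by simp
    then show ?thesis
      by (cases m rule: position_cases) (auto simp: flip_apply)
  qed
qed

text \<open>\<open>flip C\<close> is a product of disjoint transpositions, one for each edge in
  \<open>C\<close>.\<close>

lemma flip_permutes_sign:
  assumes "C \<subseteq> {..<n}"
  shows "flip C permutes {1..2*n} \<and> sign (flip C) = (- 1) ^ card C"
proof -
  have "finite C"
    using assms by (rule finite_subset) simp
  then show ?thesis
    using assms
  proof (induction C rule: finite_induct)
    case empty
    then show ?case unfolding flip_empty by (intro conjI permutes_id) simp
  next
    case (insert k C)
    let ?t = "transpose (Suc (2 * k)) (Suc (Suc (2 * k)))"
    have t: "?t permutes {1..2*n}"
      using insert.prems by (intro permutes_swap_id) auto
    have f: "flip C permutes {1..2*n}"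
      using insert by simp
    have "sign (?t \<circ> flip C) = sign ?t * sign (flip C)"
      by (rule sign_compose_permutes[OF t f]) simp
    then show ?case
      using insert permutes_compose[OF f t] unfolding flip_insert[OF insert.hyps(2)]
      by (simp add: sign_swap_id o_def)
  qed
qed

section \<open>Expansion of the Pfaffian\<close>

definition sorter :: "nat \<Rightarrow> (nat \<Rightarrow> nat) \<Rightarrow> nat \<Rightarrow> nat" where
  "sorter n key = (SOME p. p permutes {..<n} \<and> strict_mono_on {..<n} (key \<circ> p))"

lemma sorter:
  assumes "inj_on key {..<n}"
  shows "sorter n key permutes {..<n}" "strict_mono_on {..<n} (key \<circ> sorter n key)"
proof -
  have "\<exists>p. p permutes {..<n} \<and> strict_mono_on {..<n} (key \<circ> p)"
    using sorting_permutation_exists[OF assms] by blast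
  then have "sorter n key permutes {..<n} \<and> strict_mono_on {..<n} (key \<circ> sorter n key)"
    unfolding sorter_def by (rule someI_ex)
  then show "sorter n key permutes {..<n}" "strict_mono_on {..<n} (key \<circ> sorter n key)"
    by auto
qed

text \<open>
  The Pfaffian lists the edges by increasing minimum, but the subset \<open>I\<close> suggests listing them by
  increasing chosen endpoint. Both are instances of sorting the edges by a key, and since permuting
  whole edges is an even permutation, the sum does not depend on the key.
\<close>

definition pair_key :: "nat \<Rightarrow> ((nat \<Rightarrow> nat) \<Rightarrow> nat \<Rightarrow> nat) \<Rightarrow> bool" where
  "pair_key n K \<longleftrightarrow> (\<forall>\<tau>. \<tau> permutes {1..2*n} \<longrightarrow> inj_on (K \<tau>) {..<n}
     \<and> (\<forall>p k. p permutes {..<n} \<longrightarrow> k < n \<longrightarrow> K (\<tau> \<circ> pair_perm n p) k = K \<tau> (p k)))"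

definition sorted_by :: "nat \<Rightarrow> ((nat \<Rightarrow> nat) \<Rightarrow> nat \<Rightarrow> nat) \<Rightarrow> (nat \<Rightarrow> nat) set" where
  "sorted_by n K = {\<tau>. \<tau> permutes {1..2*n} \<and> strict_mono_on {..<n} (K \<tau>)}"

lemma strict_mono_on_lessThan_cong:
  fixes f g :: "nat \<Rightarrow> nat"
  assumes "\<And>k. k < n \<Longrightarrow> f k = g k"
  shows "strict_mono_on {..<n} f \<longleftrightarrow> strict_mono_on {..<n} g"
  using assms by (auto simp: strict_mono_on_def)

definition resort :: "nat \<Rightarrow> ((nat \<Rightarrow> nat) \<Rightarrow> nat \<Rightarrow> nat) \<Rightarrow> (nat \<Rightarrow> nat) \<Rightarrow> nat \<Rightarrow> nat" where
  "resort n K \<tau> = \<tau> \<circ> pair_perm n (sorter n (K \<tau>))"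

lemma resort_sorted_by:
  assumes "pair_key n K" "\<tau> permutes {1..2*n}"
  shows "resort n K \<tau> \<in> sorted_by n K"
proof -
  let ?p = "sorter n (K \<tau>)"
  have "inj_on (K \<tau>) {..<n}"
    using assms by (simp add: pair_key_def)
  note p = sorter[OF this]
  have "K (resort n K \<tau>) k = (K \<tau> \<circ> ?p) k" if "k < n" for k
    using assms p(1) that by (simp add: pair_key_def resort_def)
  then have "strict_mono_on {..<n} (K (resort n K \<tau>)) \<longleftrightarrow> strict_mono_on {..<n} (K \<tau> \<circ> ?p)"
    by (rule strict_mono_on_lessThan_cong)
  moreover have "resort n K \<tau> permutes {1..2*n}"
    unfolding resort_def by (rule permutes_compose[OF pair_perm_permutes[OF p(1)] assms(2)])
  ultimately show ?thesis
    using p(2) by (simp add: sorted_by_def)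
qed

text \<open>The two sorting permutations compose to one that sorts edges already in order; by
  uniqueness of sorting it is the identity.\<close>

lemma resort_resort:
  assumes K: "pair_key n K" and K': "pair_key n K'" and \<tau>: "\<tau> \<in> sorted_by n K"
  shows "resort n K (resort n K' \<tau>) = \<tau>"
proof -
  have perm: "\<tau> permutes {1..2*n}" and sorted: "strict_mono_on {..<n} (K \<tau>)"
    using \<tau> by (auto simp: sorted_by_def)
  let ?\<upsilon> = "resort n K' \<tau>"
  let ?p = "sorter n (K' \<tau>)"
  let ?q = "sorter n (K ?\<upsilon>)"
  have perm': "?\<upsilon> permutes {1..2*n}"
    using resort_sorted_by[OF K' perm] by (simp add: sorted_by_def)
  have inj: "inj_on (K' \<tau>) {..<n}" "inj_on (K \<tau>) {..<n}" "inj_on (K ?\<upsilon>) {..<n}"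
    using K K' perm perm' by (simp_all add: pair_key_def)
  note p = sorter[OF inj(1)] and q = sorter[OF inj(3)]
  have pq: "?p \<circ> ?q permutes {..<n}"
    by (rule permutes_compose[OF q(1) p(1)])
  have "(K ?\<upsilon> \<circ> ?q) k = (K \<tau> \<circ> (?p \<circ> ?q)) k" if "k < n" for k
  proof -
    have "?q k < n"
      using permutes_in_image[OF q(1), of k] that by simp
    then show ?thesis
      using K perm p(1) by (simp add: pair_key_def resort_def)
  qed
  then have "strict_mono_on {..<n} (K ?\<upsilon> \<circ> ?q) \<longleftrightarrow> strict_mono_on {..<n} (K \<tau> \<circ> (?p \<circ> ?q))"
    by (rule strict_mono_on_lessThan_cong)
  then have "strict_mono_on {..<n} (K \<tau> \<circ> (?p \<circ> ?q))"
    using q(2) by simp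
  then have "?p \<circ> ?q = id"
    using sorting_permutation_unique[OF inj(2) pq permutes_id] sorted by simp
  then have "pair_perm n ?p \<circ> pair_perm n ?q = id"
    by (simp only: pair_perm_compose[OF p(1) q(1)] pair_perm_id)
  then show ?thesis
    by (simp only: resort_def[of n K] resort_def[of n K' \<tau>] o_assoc[symmetric] o_id)
qed

text \<open>Among all reorderings of the edges of a given \<open>\<tau>\<close> exactly one is
  sorted by a given key. Both sums thus run over systems of representatives of the same classes, and
  \<open>resort\<close> passes from one system to the other.\<close>

lemma sum_sorted_by:
  assumes "pair_key n K" "pair_key n K'"
    and "\<And>\<tau> p. \<tau> permutes {1..2*n} \<Longrightarrow> p permutes {..<n} \<Longrightarrow> f (\<tau> \<circ> pair_perm n p) = f \<tau>"
  shows "sum f (sorted_by n K) = sum f (sorted_by n K')"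
proof (rule sum.reindex_bij_witness[where i = "resort n K" and j = "resort n K'"])
  fix \<tau> assume \<tau>: "\<tau> \<in> sorted_by n K"
  then have perm: "\<tau> permutes {1..2*n}"
    by (simp add: sorted_by_def)
  show "resort n K (resort n K' \<tau>) = \<tau>"
    by (rule resort_resort[OF assms(1,2) \<tau>])
  show "resort n K' \<tau> \<in> sorted_by n K'"
    by (rule resort_sorted_by[OF assms(2) perm])
  have "inj_on (K' \<tau>) {..<n}"
    using assms(2) perm by (simp add: pair_key_def)
  then show "f (resort n K' \<tau>) = f \<tau>"
    unfolding resort_def by (rule assms(3)[OF perm sorter(1)])
next
  fix \<tau> assume \<tau>: "\<tau> \<in> sorted_by n K'"
  show "resort n K' (resort n K \<tau>) = \<tau>"
    by (rule resort_resort[OF assms(2,1) \<tau>])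
  show "resort n K \<tau> \<in> sorted_by n K"
    by (rule resort_sorted_by[OF assms(1)]) (use \<tau> in \<open>simp add: sorted_by_def\<close>)
qed

definition min_key :: "(nat \<Rightarrow> nat) \<Rightarrow> nat \<Rightarrow> nat" where
  "min_key \<tau> k = min (\<tau> (Suc (2 * k))) (\<tau> (Suc (Suc (2 * k))))"

definition odd_key :: "(nat \<Rightarrow> nat) \<Rightarrow> nat \<Rightarrow> nat" where
  "odd_key \<tau> k = \<tau> (Suc (2 * k))"

lemma permutes_eq_iff: "p permutes S \<Longrightarrow> p a = p b \<longleftrightarrow> a = b"
  by (metis permutes_inj injD)

lemma pair_key_min_key: "pair_key n min_key"
  by (auto simp: pair_key_def min_key_def inj_on_def pair_perm_apply min_def permutes_eq_iff
      Suc_double_not_eq_double double_not_eq_Suc_double split: if_splits)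

lemma pair_key_odd_key: "pair_key n odd_key"
  by (auto simp: pair_key_def odd_key_def inj_on_def pair_perm_apply permutes_eq_iff)

text \<open>A matching with one chosen endpoint per edge is encoded by a permutation whose odd
  positions hold the chosen endpoints; \<open>sign \<tau>\<close> then already contains the minus
  signs of the terms \<open>- y j\<close>.\<close>

definition pairing_term ::
    "nat \<Rightarrow> (nat \<Rightarrow> 'a::comm_ring_1) \<Rightarrow> (nat \<Rightarrow> nat \<Rightarrow> 'a) \<Rightarrow> (nat \<Rightarrow> nat) \<Rightarrow> 'a" where
  "pairing_term n y g \<tau> = of_int (sign \<tau>)
     * (\<Prod>k<n. y (\<tau> (Suc (2 * k))) * g (\<tau> (Suc (2 * k))) (\<tau> (Suc (Suc (2 * k)))))"

lemma pairing_term_pair_perm: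
  assumes "\<tau> permutes {1..2*n}" "p permutes {..<n}"
  shows "pairing_term n y g (\<tau> \<circ> pair_perm n p) = pairing_term n y g \<tau>"
proof -
  have "sign (\<tau> \<circ> pair_perm n p) = sign \<tau>"
    using assms by (simp add: sign_compose_permutes[of _ "{1..2*n}"] pair_perm_permutes sign_pair_perm
        del: One_nat_def)
  moreover have "(\<Prod>k<n. y (\<tau> (Suc (2 * p k))) * g (\<tau> (Suc (2 * p k))) (\<tau> (Suc (Suc (2 * p k)))))
      = (\<Prod>k<n. y (\<tau> (Suc (2 * k))) * g (\<tau> (Suc (2 * k))) (\<tau> (Suc (Suc (2 * k)))))"
    using prod.permute[OF assms(2),
        of "\<lambda>k. y (\<tau> (Suc (2 * k))) * g (\<tau> (Suc (2 * k))) (\<tau> (Suc (Suc (2 * k))))"]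
    by (simp add: o_def)
  ultimately show ?thesis
    by (simp add: pairing_term_def pair_perm_apply[OF assms(2)])
qed

text \<open>Passes from edges numbered from 1 to edges numbered from 0, and from comparing
  neighbouring edges to strict monotonicity.\<close>

lemma matching_perms_iff:
  "\<sigma> \<in> matching_perms n \<longleftrightarrow> \<sigma> permutes {1..2*n}
     \<and> (\<forall>k<n. \<sigma> (Suc (2 * k)) < \<sigma> (Suc (Suc (2 * k))))
     \<and> strict_mono_on {..<n} (\<lambda>k. \<sigma> (Suc (2 * k)))"
proof -
  have "(\<forall>k\<in>{1..n}. \<sigma> (2*k - 1) < \<sigma> (2*k)) \<longleftrightarrow> (\<forall>k<n. \<sigma> (Suc (2 * k)) < \<sigma> (Suc (Suc (2 * k))))"
  proof (intro iffI allI ballI impI)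
    fix k assume "\<forall>k\<in>{1..n}. \<sigma> (2*k - 1) < \<sigma> (2*k)" "k < n"
    from this(1)[rule_format, of "Suc k"] this(2)
    show "\<sigma> (Suc (2 * k)) < \<sigma> (Suc (Suc (2 * k)))" by simp
  next
    fix k assume "\<forall>k<n. \<sigma> (Suc (2 * k)) < \<sigma> (Suc (Suc (2 * k)))" "k \<in> {1..n}"
    from this(1)[rule_format, of "k - 1"] this(2)
    show "\<sigma> (2*k - 1) < \<sigma> (2*k)" by (cases k) auto
  qed
  moreover have "(\<forall>k\<in>{1..<n}. \<sigma> (2*k - 1) < \<sigma> (2*k + 1))
      \<longleftrightarrow> strict_mono_on {..<n} (\<lambda>k. \<sigma> (Suc (2 * k)))"
  proof
    assume *: "\<forall>k\<in>{1..<n}. \<sigma> (2*k - 1) < \<sigma> (2*k + 1)"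
    show "strict_mono_on {..<n} (\<lambda>k. \<sigma> (Suc (2 * k)))"
      by (rule strict_mono_on_lessThan_SucI) (use *[rule_format, of "Suc _"] in auto)
  next
    assume *: "strict_mono_on {..<n} (\<lambda>k. \<sigma> (Suc (2 * k)))"
    show "\<forall>k\<in>{1..<n}. \<sigma> (2*k - 1) < \<sigma> (2*k + 1)"
    proof
      fix k assume "k \<in> {1..<n}"
      then show "\<sigma> (2*k - 1) < \<sigma> (2*k + 1)"
        using strict_mono_onD[OF *, of "k - 1" k] by (cases k) auto
    qed
  qed
  ultimately show ?thesis
    by (simp add: matching_perms_def)
qed

definition flips :: "nat \<Rightarrow> (nat \<Rightarrow> nat) \<Rightarrow> nat set" where
  "flips n \<tau> = {k. k < n \<and> \<tau> (Suc (Suc (2 * k))) < \<tau> (Suc (2 * k))}"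

lemma compose_flip_cancel: "(\<sigma> \<circ> flip C) \<circ> flip C = \<sigma>"
  by (simp only: o_assoc[symmetric] flip_involution o_id)

text \<open>Reversing edges keeps their minima and hence their order. Since every edge of a matching
  is listed increasingly, the reversed edges can be read off the result as its decreasing ones,
  which is what \<open>flips\<close> does.\<close>

lemma sum_matching_perms_flips:
  "(\<Sum>\<sigma>\<in>matching_perms n. \<Sum>C\<in>Pow {..<n}. f (\<sigma> \<circ> flip C)) = sum f (sorted_by n min_key)"
proof -
  have fin: "finite (matching_perms n)"
    by (rule finite_subset[OF _ finite_permutations[of "{1..2*n}"]]) (auto simp: matching_perms_def)
  have "(\<Sum>\<sigma>\<in>matching_perms n. \<Sum>C\<in>Pow {..<n}. f (\<sigma> \<circ> flip C))
      = (\<Sum>(\<sigma>, C)\<in>matching_perms n \<times> Pow {..<n}. f (\<sigma> \<circ> flip C))"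
    using fin by (simp add: sum.cartesian_product)
  also have "\<dots> = sum f (sorted_by n min_key)"
  proof (rule sum.reindex_bij_witness[where j = "\<lambda>(\<sigma>, C). \<sigma> \<circ> flip C"
        and i = "\<lambda>\<tau>. (\<tau> \<circ> flip (flips n \<tau>), flips n \<tau>)"])
    fix \<tau> assume "\<tau> \<in> sorted_by n min_key"
    then have \<tau>: "\<tau> permutes {1..2*n}" "strict_mono_on {..<n} (min_key \<tau>)"
      by (auto simp: sorted_by_def)
    let ?C = "flips n \<tau>" and ?\<sigma> = "\<tau> \<circ> flip (flips n \<tau>)"
    have C: "?C \<subseteq> {..<n}"
      by (auto simp: flips_def)
    show "(\<lambda>(\<sigma>, C). \<sigma> \<circ> flip C) (?\<sigma>, ?C) = \<tau>"
      by (simp only: prod.case compose_flip_cancel)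
    have "?\<sigma> (Suc (2 * k)) = min_key \<tau> k" "?\<sigma> (Suc (2 * k)) < ?\<sigma> (Suc (Suc (2 * k)))" if "k < n" for k
      using that permutes_eq_iff[OF \<tau>(1), of "Suc (2 * k)" "Suc (Suc (2 * k))"]
      by (auto simp: flip_apply flips_def min_key_def)
    moreover from this(1)
    have "strict_mono_on {..<n} (\<lambda>k. ?\<sigma> (Suc (2 * k))) \<longleftrightarrow> strict_mono_on {..<n} (min_key \<tau>)"
      by (rule strict_mono_on_lessThan_cong)
    moreover have "?\<sigma> permutes {1..2*n}"
      using flip_permutes_sign[OF C] \<tau>(1) by (intro permutes_compose) auto
    ultimately show "(?\<sigma>, ?C) \<in> matching_perms n \<times> Pow {..<n}"
      using C \<tau>(2) by (simp add: matching_perms_iff)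
  next
    fix z assume "z \<in> matching_perms n \<times> Pow {..<n}"
    then obtain \<sigma> C where z: "z = (\<sigma>, C)" and C: "C \<subseteq> {..<n}" and \<sigma>: "\<sigma> permutes {1..2*n}"
        "\<And>k. k < n \<Longrightarrow> \<sigma> (Suc (2 * k)) < \<sigma> (Suc (Suc (2 * k)))"
        "strict_mono_on {..<n} (\<lambda>k. \<sigma> (Suc (2 * k)))"
      by (auto simp: matching_perms_iff)
    have "k \<in> flips n (\<sigma> \<circ> flip C) \<longleftrightarrow> k \<in> C" for k
      using C \<sigma>(2)[of k] by (auto simp: flips_def flip_apply)
    then have "flips n (\<sigma> \<circ> flip C) = C"
      by blast
    then show "(\<lambda>\<tau>. (\<tau> \<circ> flip (flips n \<tau>), flips n \<tau>)) ((\<lambda>(\<sigma>, C). \<sigma> \<circ> flip C) z) = z"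
      by (simp only: z prod.case compose_flip_cancel)
    have "min_key (\<sigma> \<circ> flip C) k = \<sigma> (Suc (2 * k))" if "k < n" for k
      using \<sigma>(2)[OF that] by (auto simp: min_key_def flip_apply)
    then have "strict_mono_on {..<n} (min_key (\<sigma> \<circ> flip C)) \<longleftrightarrow> strict_mono_on {..<n} (\<lambda>k. \<sigma> (Suc (2 * k)))"
      by (rule strict_mono_on_lessThan_cong)
    moreover have "\<sigma> \<circ> flip C permutes {1..2*n}"
      using flip_permutes_sign[OF C] \<sigma>(1) by (intro permutes_compose) auto
    ultimately show "(\<lambda>(\<sigma>, C). \<sigma> \<circ> flip C) z \<in> sorted_by n min_key"
      using \<sigma>(3) by (simp add: z sorted_by_def)
  qed auto
  finally show ?thesis .
qed

text \<open>Choosing \<open>- y j\<close> from the edge \<open>(i, j)\<close> is the same as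
  choosing the first endpoint of the reversed edge \<open>(j, i)\<close>: the reversal negates the
  sign of the permutation, and the symmetric \<open>g\<close> does not see it.\<close>

lemma pfaffian_eq_sum_min_key:
  fixes y :: "nat \<Rightarrow> 'a::comm_ring_1"
  assumes "\<And>i j. g i j = g j i"
  shows "pfaffian n (\<lambda>i j. (y i - y j) * g i j) = sum (pairing_term n y g) (sorted_by n min_key)"
proof -
  have expand: "of_int (sign \<sigma>) * (\<Prod>k=1..n. (y (\<sigma> (2*k - 1)) - y (\<sigma> (2*k))) * g (\<sigma> (2*k - 1)) (\<sigma> (2*k)))
      = (\<Sum>C\<in>Pow {..<n}. pairing_term n y g (\<sigma> \<circ> flip C))" if "\<sigma> \<in> matching_perms n" for \<sigma>
  proof -
    have \<sigma>: "\<sigma> permutes {1..2*n}"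
      using that by (simp add: matching_perms_def)
    define y1 y2 G where "y1 k = y (\<sigma> (Suc (2 * k)))" and "y2 k = y (\<sigma> (Suc (Suc (2 * k))))"
      and "G k = g (\<sigma> (Suc (2 * k))) (\<sigma> (Suc (Suc (2 * k))))" for k
    have "(\<Prod>k=1..n. (y (\<sigma> (2*k - 1)) - y (\<sigma> (2*k))) * g (\<sigma> (2*k - 1)) (\<sigma> (2*k)))
        = (\<Prod>k<n. (y1 k - y2 k) * G k)"
      unfolding One_nat_def prod.atLeast1_atMost_eq y1_def y2_def G_def
      by (rule prod.cong) simp_all
    also have "\<dots> = (\<Sum>C\<in>Pow {..<n}. (- 1) ^ card C * (\<Prod>k\<in>C. y2 k) * (\<Prod>k\<in>{..<n} - C. y1 k))
        * (\<Prod>k<n. G k)"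
      by (simp add: prod.distrib prod_diff_conv_sum)
    finally have *: "(\<Prod>k=1..n. (y (\<sigma> (2*k - 1)) - y (\<sigma> (2*k))) * g (\<sigma> (2*k - 1)) (\<sigma> (2*k)))
        = (\<Sum>C\<in>Pow {..<n}. (- 1) ^ card C * (\<Prod>k\<in>C. y2 k) * (\<Prod>k\<in>{..<n} - C. y1 k))
        * (\<Prod>k<n. G k)" .
    show ?thesis
      unfolding * sum_distrib_left sum_distrib_right
    proof (rule sum.cong)
      fix C assume "C \<in> Pow {..<n}"
      then have C: "C \<subseteq> {..<n}" by simp
      have "sign (\<sigma> \<circ> flip C) = sign \<sigma> * (- 1) ^ card C"
        using flip_permutes_sign[OF C] sign_compose_permutes[OF \<sigma>, of "flip C"] by simp
      moreover have "(\<Prod>k<n. y ((\<sigma> \<circ> flip C) (Suc (2 * k)))) = (\<Prod>k\<in>C. y2 k) * (\<Prod>k\<in>{..<n} - C. y1 k)"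
      proof -
        have "(\<Prod>k\<in>C. y ((\<sigma> \<circ> flip C) (Suc (2 * k)))) = (\<Prod>k\<in>C. y2 k)"
          by (rule prod.cong) (simp_all add: flip_apply y2_def)
        moreover have "(\<Prod>k\<in>{..<n} - C. y ((\<sigma> \<circ> flip C) (Suc (2 * k)))) = (\<Prod>k\<in>{..<n} - C. y1 k)"
          by (rule prod.cong) (simp_all add: flip_apply y1_def)
        ultimately show ?thesis
          unfolding prod.subset_diff[OF C finite_lessThan] by (simp only: mult.commute)
      qed
      moreover have "(\<Prod>k<n. g ((\<sigma> \<circ> flip C) (Suc (2 * k))) ((\<sigma> \<circ> flip C) (Suc (Suc (2 * k))))) = (\<Prod>k<n. G k)"
        by (rule prod.cong) (auto simp: flip_apply G_def assms)
      ultimately show "of_int (sign \<sigma>) * ((- 1) ^ card C * (\<Prod>k\<in>C. y2 k) * (\<Prod>k\<in>{..<n} - C. y1 k) * (\<Prod>k<n. G k))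
          = pairing_term n y g (\<sigma> \<circ> flip C)"
        unfolding pairing_term_def prod.distrib by (simp add: mult_ac)
    qed simp
  qed
  show ?thesis
    unfolding pfaffian_def sum_matching_perms_flips[symmetric]
    by (rule sum.cong[OF refl expand])
qed

lemma pfaffian_eq_sum_odd_key:
  fixes y :: "nat \<Rightarrow> 'a::comm_ring_1"
  assumes "\<And>i j. g i j = g j i"
  shows "pfaffian n (\<lambda>i j. (y i - y j) * g i j) = sum (pairing_term n y g) (sorted_by n odd_key)"
  unfolding pfaffian_eq_sum_min_key[OF assms]
  by (rule sum_sorted_by[OF pair_key_min_key pair_key_odd_key]) (rule pairing_term_pair_perm)

section \<open>Subsets of size n and their permutations\<close>

text \<open>As a list of edges this joins elements of equal rank in \<open>I\<close> and its
  complement. It is the reference matching from which every other bijection differs by an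
  \<open>even_perm\<close>.\<close>

definition subset_perm :: "nat \<Rightarrow> nat set \<Rightarrow> nat \<Rightarrow> nat" where
  "subset_perm n I m = (if m \<in> {1..2*n}
     then if odd m then enum I ((m - 1) div 2) else enum ({1..2*n} - I) ((m - 1) div 2)
     else m)"

lemma subset_perm_apply:
  assumes "k < n"
  shows "subset_perm n I (Suc (2 * k)) = enum I k"
    and "subset_perm n I (Suc (Suc (2 * k))) = enum ({1..2*n} - I) k"
  using assms by (simp_all add: subset_perm_def)

lemma half_subset:
  assumes "I \<subseteq> {1..2*n}" "card I = n"
  shows "finite I" "finite ({1..2*n} - I)" "card ({1..2*n} - I) = n"
    and "bij_betw (enum I) {..<n} I" "bij_betw (enum ({1..2*n} - I)) {..<n} ({1..2*n} - I)"
    and "strict_mono_on {..<n} (enum I)" "strict_mono_on {..<n} (enum ({1..2*n} - I))"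
proof -
  show fin: "finite I" "finite ({1..2*n} - I)"
    using finite_subset[OF assms(1)] by auto
  show card: "card ({1..2*n} - I) = n"
    using assms fin by (simp add: card_Diff_subset)
  show "bij_betw (enum I) {..<n} I" "bij_betw (enum ({1..2*n} - I)) {..<n} ({1..2*n} - I)"
    using bij_betw_enum[OF fin(1)] bij_betw_enum[OF fin(2)] by (simp_all only: assms(2) card)
  show "strict_mono_on {..<n} (enum I)" "strict_mono_on {..<n} (enum ({1..2*n} - I))"
    using strict_mono_on_enum[of I] strict_mono_on_enum[of "{1..2*n} - I"]
    by (simp_all only: assms(2) card)
qed

lemma subset_perm_permutes:
  assumes I: "I \<subseteq> {1..2*n}" "card I = n"
  shows "subset_perm n I permutes {1..2*n}"
proof (rule inj_imp_permutes)
  note enum = half_subset(4,5)[OF I]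
  have in_I: "enum I k \<in> I" "enum ({1..2*n} - I) k \<in> {1..2*n} - I" if "k < n" for k
    using that bij_betwE[OF enum(1)] bij_betwE[OF enum(2)] by auto
  show "subset_perm n I m \<in> {1..2*n}" if "m \<in> {1..2*n}" for m
    using that
  proof (cases m rule: position_cases)
    case (1 k)
    then show ?thesis
      using in_I(1)[of k] I(1) by (simp only: subset_perm_apply) auto
  next
    case (2 k)
    then show ?thesis
      using in_I(2)[of k] by (simp only: subset_perm_apply) auto
  qed
  show "inj_on (subset_perm n I) {1..2*n}"
  proof (rule inj_onI)
    fix l m assume lm: "l \<in> {1..2*n}" "m \<in> {1..2*n}" "subset_perm n I l = subset_perm n I m"
    have inj: "enum I i = enum I j \<longleftrightarrow> i = j"
      "enum ({1..2*n} - I) i = enum ({1..2*n} - I) j \<longleftrightarrow> i = j" if "i < n" "j < n" for i j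
      using that inj_on_eq_iff[OF bij_betw_imp_inj_on[OF enum(1)]]
        inj_on_eq_iff[OF bij_betw_imp_inj_on[OF enum(2)]] by auto
    have disj: "enum I i \<noteq> enum ({1..2*n} - I) j" if "i < n" "j < n" for i j
      using in_I(1)[OF that(1)] in_I(2)[OF that(2)] by auto
    from lm(1) show "l = m"
    proof (cases l rule: position_cases)
      case (1 i)
      from lm(2) show ?thesis
      proof (cases m rule: position_cases)
        case (1 j)
        then show ?thesis using lm(3) \<open>i < n\<close> \<open>l = _\<close> by (simp only: subset_perm_apply inj)
      next
        case (2 j)
        then show ?thesis using lm(3) \<open>i < n\<close> \<open>l = _\<close> disj by (simp only: subset_perm_apply)
      qed
    next
      case (2 i)
      from lm(2) show ?thesis
      proof (cases m rule: position_cases)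
        case (1 j)
        then show ?thesis using lm(3)[symmetric] \<open>i < n\<close> \<open>l = _\<close> disj by (simp only: subset_perm_apply)
      next
        case (2 j)
        then show ?thesis using lm(3) \<open>i < n\<close> \<open>l = _\<close> by (simp only: subset_perm_apply inj)
      qed
    qed
  qed
  show "subset_perm n I m = m" if "m \<notin> {1..2*n}" for m
    unfolding subset_perm_def using that by (simp only: if_False)
qed simp

text \<open>Exchanging the neighbours \<open>i\<close> and \<open>Suc i\<close> disturbs only the
  comparison between these two, so it stays increasing on a set that does not contain both.\<close>

lemma enum_transpose:
  fixes i :: nat
  assumes "bij_betw (enum S) {..<n} S" "strict_mono_on {..<n} (enum S)"
    and "\<not> (i \<in> S \<and> Suc i \<in> S)" "k < n"
  shows "enum (transpose i (Suc i) ` S) k = transpose i (Suc i) (enum S k)"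
proof -
  let ?f = "transpose i (Suc i) \<circ> enum S"
  have "strict_mono_on {..<n} ?f"
  proof (rule strict_mono_onI)
    fix p q assume pq: "p \<in> {..<n}" "q \<in> {..<n}" "p < q"
    then have "enum S p < enum S q" "enum S p \<in> S" "enum S q \<in> S"
      using strict_mono_onD[OF assms(2)] bij_betwE[OF assms(1)] by auto
    then show "?f p < ?f q"
      using assms(3) by (auto simp: transpose_def)
  qed
  from enum_unique[OF this assms(4)] show ?thesis
    by (simp only: image_comp[symmetric] bij_betw_imp_surj_on[OF assms(1)] o_apply)
qed

text \<open>\<open>I\<close> and its complement contain one of the two neighbours each, so both
  enumerations commute with the transposition, and \<open>subset_perm\<close> is composed with
  it.\<close>

lemma subset_perm_transpose:
  assumes I: "I \<subseteq> {1..2*n}" "card I = n" and i: "i \<ge> 1" "i \<notin> I" "Suc i \<in> I"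
  defines "I' \<equiv> transpose i (Suc i) ` I"
  shows "I' \<subseteq> {1..2*n}" "card I' = n" "\<Sum>I = Suc (\<Sum>I')"
    and "sign (subset_perm n I') = - sign (subset_perm n I)"
proof -
  let ?t = "transpose i (Suc i)"
  have iI: "Suc i \<in> {1..2*n}" "i \<in> {1..2*n}"
    using i I(1) by auto
  have t: "?t permutes {1..2*n}"
    using iI by (intro permutes_swap_id) auto
  have I'_eq: "I' = insert i (I - {Suc i})"
    using i by (auto simp: I'_def transpose_def image_iff)
  show I'_sub: "I' \<subseteq> {1..2*n}"
    using iI I(1) unfolding I'_eq by auto
  show I'_card: "card I' = n"
    unfolding I'_def using I(2) by (simp add: card_image)
  have fin: "finite I"
    by (rule half_subset(1)[OF I])
  have "\<Sum>I' = i + \<Sum>(I - {Suc i})"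
    unfolding I'_eq using fin i by simp
  moreover have "\<Sum>I = Suc i + \<Sum>(I - {Suc i})"
    using fin i by (simp add: sum.remove[of I "Suc i"])
  ultimately show "\<Sum>I = Suc (\<Sum>I')"
    by simp
  have compl: "{1..2*n} - I' = ?t ` ({1..2*n} - I)"
    unfolding I'_def by (simp only: image_set_diff[OF permutes_inj[OF t]] permutes_image[OF t])
  have "subset_perm n I' = ?t \<circ> subset_perm n I"
  proof (rule permutes_positions_eqI)
    show "subset_perm n I' permutes {1..2*n}"
      by (rule subset_perm_permutes[OF I'_sub I'_card])
    show "?t \<circ> subset_perm n I permutes {1..2*n}"
      by (rule permutes_compose[OF subset_perm_permutes[OF I] t])
    fix k assume k: "k < n"
    have "enum I' k = ?t (enum I k)"
      unfolding I'_def by (rule enum_transpose[OF half_subset(4,6)[OF I] _ k]) (use i in simp)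
    then show "subset_perm n I' (Suc (2 * k)) = (?t \<circ> subset_perm n I) (Suc (2 * k))"
      by (simp only: subset_perm_apply[OF k] o_apply)
    have "enum ({1..2*n} - I') k = ?t (enum ({1..2*n} - I) k)"
      unfolding compl by (rule enum_transpose[OF half_subset(5,7)[OF I] _ k]) (use i in simp)
    then show "subset_perm n I' (Suc (Suc (2 * k))) = (?t \<circ> subset_perm n I) (Suc (Suc (2 * k)))"
      by (simp only: subset_perm_apply[OF k] o_apply)
  qed
  then show "sign (subset_perm n I') = - sign (subset_perm n I)"
    using sign_compose_permutes[OF t subset_perm_permutes[OF I]] by (simp add: sign_swap_id)
qed

text \<open>
  Replacing an element \<open>i + 1\<close> of \<open>I\<close> by \<open>i\<close> flips the sign of the permutation and the
  parity of \<open>\<Sum>I\<close>; such steps lead from any \<open>I\<close> down to \<open>{1..n}\<close>.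
\<close>

lemma down_closed_eq_initial:
  assumes "I \<subseteq> {1..2*n}" "card I = n" and down: "\<And>i. i \<ge> 1 \<Longrightarrow> Suc i \<in> I \<Longrightarrow> i \<in> I"
  shows "I = {1..n}"
proof (cases "I = {}")
  case True
  then show ?thesis using assms(2) by auto
next
  case False
  have fin: "finite I"
    by (rule half_subset(1)[OF assms(1,2)])
  have "Max I - d \<in> I" if "d < Max I" for d
    using that
  proof (induction d)
    case 0
    then show ?case using fin False by simp
  next
    case (Suc d)
    then show ?case
      using down[of "Max I - Suc d"] by (simp add: Suc_diff_Suc)
  qed
  then have "m \<in> I" if "m \<in> {1..Max I}" for m
    using that by (metis atLeastAtMost_iff diff_diff_cancel diff_less less_le_trans less_numeral_extra(1))
  then have "I = {1..Max I}"
    using fin assms(1) by auto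
  then show ?thesis
    using assms(2) by (metis card_atLeastAtMost diff_Suc_1)
qed

text \<open>The product of the two signs is invariant under each step. The bound on
  \<open>\<Sum>I\<close> comes out of the same descent, and it is what makes the truncated
  subtraction in \<open>subset_weight\<close> exact.\<close>

lemma subset_perm_sign_descent:
  assumes "I \<subseteq> {1..2*n}" "card I = n"
  shows "\<Sum>I \<ge> \<Sum>{1..n} \<and>
    sign (subset_perm n I) * (- 1) ^ \<Sum>I = sign (subset_perm n {1..n}) * (- 1) ^ \<Sum>{1..n}"
  using assms
proof (induction "\<Sum>I" arbitrary: I rule: less_induct)
  case less
  show ?case
  proof (cases "\<exists>i\<ge>1. i \<notin> I \<and> Suc i \<in> I")
    case True
    then obtain i where i: "i \<ge> 1" "i \<notin> I" "Suc i \<in> I" by blast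
    let ?I' = "transpose i (Suc i) ` I"
    note I' = subset_perm_transpose[OF less.prems i]
    have "\<Sum>?I' < \<Sum>I"
      using I'(3) by simp
    from less.hyps[OF this I'(1,2)] show ?thesis
      by (auto simp only: I'(3,4) power_Suc)
  next
    case False
    then have "I = {1..n}"
      by (intro down_closed_eq_initial[OF less.prems]) blast
    then show ?thesis by simp
  qed
qed

lemma sum_half_subset_ge:
  assumes "I \<subseteq> {1..2*n}" "card I = n"
  shows "\<Sum>I \<ge> Suc n choose 2"
proof -
  have "\<Sum>{1..n} = Suc n choose 2"
    using gauss_sum_from_Suc_0[of n, where 'a = nat] by (simp add: choose_two)
  then show ?thesis
    using subset_perm_sign_descent[OF assms] by simp
qed

text \<open>The constant in the descent is found at the odd numbers, where the permutation is trivial.\<close>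

lemma sign_subset_perm:
  assumes "I \<subseteq> {1..2*n}" "card I = n"
  shows "sign (subset_perm n I) = (- 1) ^ (\<Sum>I + n)"
proof -
  let ?o = "\<lambda>k. Suc (2 * k)" and ?e = "\<lambda>k. Suc (Suc (2 * k))"
  let ?O = "?o ` {..<n}"
  have O: "?O \<subseteq> {1..2*n}" "card ?O = n"
    by (auto simp: card_image inj_on_def)
  have compl: "{1..2*n} - ?O = ?e ` {..<n}"
  proof (intro equalityI subsetI)
    fix m assume "m \<in> {1..2*n} - ?O"
    then have "m \<in> {1..2*n}" "m \<notin> ?O" by auto
    then show "m \<in> ?e ` {..<n}"
      by (cases m rule: position_cases) auto
  qed (auto simp: Suc_double_not_eq_double double_not_eq_Suc_double)
  have mono: "strict_mono_on {..<n} ?o" "strict_mono_on {..<n} ?e"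
    by (auto simp: strict_mono_on_def)
  have "subset_perm n ?O = id"
  proof (rule permutes_positions_eqI[OF subset_perm_permutes[OF O] permutes_id])
    fix k assume k: "k < n"
    show "subset_perm n ?O (Suc (2 * k)) = id (Suc (2 * k))"
      by (simp only: subset_perm_apply[OF k] enum_unique[OF mono(1) k] id_apply)
    show "subset_perm n ?O (Suc (Suc (2 * k))) = id (Suc (Suc (2 * k)))"
      by (simp only: subset_perm_apply[OF k] compl enum_unique[OF mono(2) k] id_apply)
  qed
  \<comment> \<open>The square \<open>n\<^sup>2\<close> has the parity of \<open>n\<close>; this is
    the \<open>n\<close> in the exponent.\<close>
  moreover have "\<Sum>?O = n\<^sup>2"
  proof -
    have "\<Sum>?O = (\<Sum>k<n. Suc (2 * k))"
      by (subst sum.reindex) (auto simp: inj_on_def)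
    also have "\<dots> = n\<^sup>2"
      by (induction n) (auto simp: power2_eq_square)
    finally show ?thesis .
  qed
  ultimately have "sign (subset_perm n I) * (- 1) ^ \<Sum>I = (- 1 :: int) ^ n"
    using subset_perm_sign_descent[OF assms] subset_perm_sign_descent[OF O] by (simp add: minus_one_power_iff)
  moreover have "(- 1 :: int) ^ \<Sum>I * (- 1) ^ \<Sum>I = 1"
    by (simp add: minus_one_power_iff)
  then have "sign (subset_perm n I) = sign (subset_perm n I) * (- 1) ^ \<Sum>I * (- 1) ^ \<Sum>I"
    by (simp only: mult.assoc mult_1_right)
  ultimately show ?thesis
    by (simp only: power_add mult.commute)
qed

section \<open>Permutations sorted by chosen endpoints as pairs of a subset and a bijection\<close>

text \<open>Fixing the odd positions leaves an action on the even ones, which halving transports to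
  the indices below \<open>n\<close>.\<close>

lemma even_perm_surj:
  assumes "\<delta> permutes {1..2*n}" "\<And>k. k < n \<Longrightarrow> \<delta> (Suc (2 * k)) = Suc (2 * k)"
  obtains p where "p permutes {..<n}" "even_perm n p = \<delta>"
proof -
  let ?e = "\<lambda>k. Suc (Suc (2 * k))" and ?h = "\<lambda>m. (m - 2) div 2"
  let ?E = "?e ` {..<n}"
  have "\<delta> permutes ?E"
  proof (rule permutes_superset[OF assms(1)])
    fix m assume "m \<in> {1..2*n} - ?E"
    then have "m \<in> {1..2*n}" "m \<notin> ?E" by auto
    then show "\<delta> m = m"
      by (cases m rule: position_cases) (auto simp: assms(2))
  qed
  moreover have bij: "bij_betw ?h ?E {..<n}"
    by (rule bij_betw_byWitness[where f' = ?e]) auto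
  ultimately have "map_permutation ?E ?h \<delta> permutes {..<n}"
    by (intro map_permutation_permutes)
  moreover have "even_perm n (map_permutation ?E ?h \<delta>) = \<delta>"
    unfolding even_perm_def
    by (rule map_permutation_compose_inv[OF bij \<open>\<delta> permutes ?E\<close>]) auto
  ultimately show ?thesis
    by (rule that)
qed

lemma subset_perm_even_perm_apply:
  assumes "p permutes {..<n}" "k < n"
  shows "(subset_perm n I \<circ> even_perm n p) (Suc (2 * k)) = enum I k"
    and "(subset_perm n I \<circ> even_perm n p) (Suc (Suc (2 * k))) = enum ({1..2*n} - I) (p k)"
proof -
  have "p k < n"
    using assms permutes_in_image[OF assms(1), of k] by simp
  then show "(subset_perm n I \<circ> even_perm n p) (Suc (2 * k)) = enum I k"
    "(subset_perm n I \<circ> even_perm n p) (Suc (Suc (2 * k))) = enum ({1..2*n} - I) (p k)"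
    by (simp_all only: o_apply even_perm_apply[OF assms(1)] subset_perm_apply assms(2))
qed

definition half_subsets :: "nat \<Rightarrow> nat set set" where
  "half_subsets n = {I. I \<subseteq> {1..2*n} \<and> card I = n}"

lemma finite_half_subsets: "finite (half_subsets n)"
  by (rule finite_subset[of _ "Pow {1..2*n}"]) (auto simp: half_subsets_def)

text \<open>The entries at odd positions form \<open>I\<close>, and being sorted they agree with
  \<open>enum I\<close>. Undoing \<open>subset_perm n I\<close> therefore leaves a permutation that
  fixes the odd positions, that is, an \<open>even_perm\<close>; its \<open>p\<close> is the
  bijection from \<open>I\<close> to the complement written in ranks.\<close>

lemma bij_betw_sorted_by_odd_key:
  "bij_betw (\<lambda>(I, p). subset_perm n I \<circ> even_perm n p)
     (half_subsets n \<times> {p. p permutes {..<n}}) (sorted_by n odd_key)"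
  unfolding bij_betw_def
proof (intro conjI equalityI subsetI)
  let ?F = "\<lambda>(I, p). subset_perm n I \<circ> even_perm n p"
  let ?D = "half_subsets n \<times> {p. p permutes {..<n}}"
  show "inj_on ?F ?D"
  proof (rule inj_onI)
    fix z w assume zw: "z \<in> ?D" "w \<in> ?D" "?F z = ?F w"
    obtain I p K q where eq: "z = (I, p)" "w = (K, q)"
      by (metis surj_pair)
    have I: "I \<subseteq> {1..2*n}" "card I = n" and K: "K \<subseteq> {1..2*n}" "card K = n"
      and p: "p permutes {..<n}" and q: "q permutes {..<n}"
      using zw by (auto simp: eq half_subsets_def)
    have F: "subset_perm n I \<circ> even_perm n p = subset_perm n K \<circ> even_perm n q"
      using zw(3) by (simp only: eq prod.case)
    have "enum I k = enum K k" if "k < n" for k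
      using fun_cong[OF F, of "Suc (2 * k)"]
      by (simp only: subset_perm_even_perm_apply[OF p that] subset_perm_even_perm_apply[OF q that])
    then have "enum I ` {..<n} = enum K ` {..<n}"
      by (intro image_cong) auto
    then have IK: "I = K"
      using half_subset(4)[OF I] half_subset(4)[OF K] by (simp add: bij_betw_def)
    have "p k = q k" for k
    proof (cases "k < n")
      case True
      have "enum ({1..2*n} - I) (p k) = enum ({1..2*n} - I) (q k)"
        using fun_cong[OF F, of "Suc (Suc (2 * k))"]
        by (simp only: IK subset_perm_even_perm_apply[OF p True] subset_perm_even_perm_apply[OF q True])
      moreover have "p k \<in> {..<n}" "q k \<in> {..<n}"
        using True permutes_in_image[OF p, of k] permutes_in_image[OF q, of k] by auto
      ultimately show ?thesis
        by (rule inj_onD[OF bij_betw_imp_inj_on[OF half_subset(5)[OF I]]])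
    next
      case False
      then show ?thesis
        using permutes_not_in[OF p] permutes_not_in[OF q] by simp
    qed
    then show "z = w"
      using IK by (auto simp: eq)
  qed
  fix \<tau>
  {
    assume "\<tau> \<in> ?F ` ?D"
    then obtain I p where I: "I \<subseteq> {1..2*n}" "card I = n" and p: "p permutes {..<n}"
      and \<tau>: "\<tau> = subset_perm n I \<circ> even_perm n p"
      by (auto simp: half_subsets_def)
    have "odd_key \<tau> k = enum I k" if "k < n" for k
      unfolding odd_key_def \<tau> by (rule subset_perm_even_perm_apply[OF p that])
    then have "strict_mono_on {..<n} (odd_key \<tau>) \<longleftrightarrow> strict_mono_on {..<n} (enum I)"
      by (rule strict_mono_on_lessThan_cong)
    moreover have "\<tau> permutes {1..2*n}"
      unfolding \<tau> by (rule permutes_compose[OF even_perm_permutes'[OF p] subset_perm_permutes[OF I]])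
    ultimately show "\<tau> \<in> sorted_by n odd_key"
      using half_subset(6)[OF I] by (simp add: sorted_by_def)
  next
    assume "\<tau> \<in> sorted_by n odd_key"
    then have \<tau>: "\<tau> permutes {1..2*n}" "strict_mono_on {..<n} (odd_key \<tau>)"
      by (auto simp: sorted_by_def)
    let ?I = "odd_key \<tau> ` {..<n}"
    have "odd_key \<tau> k \<in> {1..2*n}" if "k < n" for k
      unfolding odd_key_def using that permutes_in_image[OF \<tau>(1)] by simp
    then have I: "?I \<subseteq> {1..2*n}" "card ?I = n"
      using strict_mono_on_imp_inj_on[OF \<tau>(2)] by (auto simp: card_image)
    let ?s = "subset_perm n ?I"
    have s: "?s permutes {1..2*n}"
      by (rule subset_perm_permutes[OF I])
    have "inv_into UNIV ?s \<circ> \<tau> permutes {1..2*n}"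
      by (rule permutes_compose[OF \<tau>(1) permutes_inv[OF s]])
    moreover have "(inv_into UNIV ?s \<circ> \<tau>) (Suc (2 * k)) = Suc (2 * k)" if "k < n" for k
    proof -
      have "?s (Suc (2 * k)) = \<tau> (Suc (2 * k))"
        by (simp only: subset_perm_apply[OF that] enum_unique[OF \<tau>(2) that] odd_key_def)
      then show ?thesis
        by (metis comp_apply permutes_inverses(2)[OF s])
    qed
    ultimately obtain p where p: "p permutes {..<n}" "even_perm n p = inv_into UNIV ?s \<circ> \<tau>"
      by (rule even_perm_surj)
    have "?s \<circ> even_perm n p = \<tau>"
      by (simp only: p(2) o_assoc permutes_inv_o[OF s] id_o)
    then show "\<tau> \<in> ?F ` ?D"
      using I p(1) by (intro image_eqI[of _ _ "(?I, p)"]) (auto simp: half_subsets_def)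
  }
qed

section \<open>The Pfaffian identity\<close>

text \<open>For fixed \<open>I\<close> the sum over \<open>p\<close> is a Leibniz expansion, because
  \<open>even_perm n p\<close> has the sign of \<open>p\<close>. Here \<open>g\<close> is any
  symmetric function; the special denominators enter only with the Cauchy determinant.\<close>

lemma pfaffian_eq_sum_det:
  fixes y :: "nat \<Rightarrow> 'a::comm_ring_1"
  assumes "\<And>i j. g i j = g j i"
  shows "pfaffian n (\<lambda>i j. (y i - y j) * g i j)
    = (\<Sum>I\<in>half_subsets n. of_int (sign (subset_perm n I)) * (\<Prod>i\<in>I. y i)
        * det (mat n n (\<lambda>(i, j). g (enum I i) (enum ({1..2*n} - I) j))))"
proof -
  let ?t = "pairing_term n y g"
  have "pfaffian n (\<lambda>i j. (y i - y j) * g i j)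
      = (\<Sum>z\<in>half_subsets n \<times> {p. p permutes {..<n}}.
          ?t ((\<lambda>(I, p). subset_perm n I \<circ> even_perm n p) z))"
    unfolding pfaffian_eq_sum_odd_key[OF assms]
    by (rule sum.reindex_bij_betw[OF bij_betw_sorted_by_odd_key, symmetric])
  also have "\<dots> = (\<Sum>I\<in>half_subsets n. \<Sum>p | p permutes {..<n}. ?t (subset_perm n I \<circ> even_perm n p))"
    by (simp only: sum.cartesian_product prod.case case_prod_unfold)
  also have "\<dots> = (\<Sum>I\<in>half_subsets n. of_int (sign (subset_perm n I)) * (\<Prod>i\<in>I. y i)
        * det (mat n n (\<lambda>(i, j). g (enum I i) (enum ({1..2*n} - I) j))))"
    unfolding det_mat_leibniz sum_distrib_left
  proof (rule sum.cong[OF refl], rule sum.cong[OF refl])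
    fix I p assume "I \<in> half_subsets n" "p \<in> {p. p permutes {..<n}}"
    then have I: "I \<subseteq> {1..2*n}" "card I = n" and p: "p permutes {..<n}"
      by (auto simp: half_subsets_def)
    have sign: "sign (subset_perm n I \<circ> even_perm n p) = sign (subset_perm n I) * sign p"
      using sign_compose_permutes[OF subset_perm_permutes[OF I] even_perm_permutes'[OF p]]
      by (simp add: sign_even_perm[OF p])
    have "(\<Prod>k<n. y (enum I k)) = (\<Prod>i\<in>I. y i)"
      by (rule prod.reindex_bij_betw[OF half_subset(4)[OF I]])
    moreover have "?t (subset_perm n I \<circ> even_perm n p)
        = of_int (sign (subset_perm n I) * sign p)
          * (\<Prod>k<n. y (enum I k) * g (enum I k) (enum ({1..2*n} - I) (p k)))"
      unfolding pairing_term_def sign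
      by (intro arg_cong2[where f = "(*)"] refl prod.cong)
        (simp_all only: subset_perm_even_perm_apply[OF p] lessThan_iff)
    ultimately show "?t (subset_perm n I \<circ> even_perm n p)
        = of_int (sign (subset_perm n I)) * (\<Prod>i\<in>I. y i)
          * (signof p * (\<Prod>i<n. g (enum I i) (enum ({1..2*n} - I) (p i))))"
      by (simp add: prod.distrib mult_ac)
  qed
  finally show ?thesis .
qed

section \<open>Products over pairs of indices and the determinant attached to a subset\<close>

definition pairs :: "nat set \<Rightarrow> (nat \<times> nat) set" where
  "pairs S = {(i, j). i \<in> S \<and> j \<in> S \<and> i < j}"

lemma finite_pairs: "finite S \<Longrightarrow> finite (pairs S)"
  by (rule finite_subset[of _ "S \<times> S"]) (auto simp: pairs_def)

text \<open>Translates the product in \<open>Delta\<close> into the nested products over ranks that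
  occur in the Cauchy determinant. As \<open>enum S\<close> is increasing, a skew factor such as
  \<open>x i - x j\<close> keeps its orientation.\<close>

lemma prod_pairs_enum:
  assumes "finite S"
  shows "(\<Prod>(i, j)\<in>pairs S. f i j) = (\<Prod>q<card S. \<Prod>p<q. f (enum S p) (enum S q))"
proof -
  let ?n = "card S"
  let ?D = "SIGMA q:{..<?n}. {..<q}"
  note bij = bij_betw_enum[OF assms]
  have mono: "enum S p < enum S q" if "p < q" "q < ?n" for p q
    using strict_mono_onD[OF strict_mono_on_enum[of S], of p q] that by auto
  have mem: "enum S p \<in> S" if "p < ?n" for p
    using bij_betwE[OF bij] that by auto
  have "bij_betw (\<lambda>(q, p). (enum S p, enum S q)) ?D (pairs S)"
    unfolding bij_betw_def
  proof (intro conjI equalityI subsetI)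
    show "inj_on (\<lambda>(q, p). (enum S p, enum S q)) ?D"
      using inj_onD[OF bij_betw_imp_inj_on[OF bij]] by (auto simp: inj_on_def)
    fix z assume "z \<in> (\<lambda>(q, p). (enum S p, enum S q)) ` ?D"
    then show "z \<in> pairs S"
      using mono mem by (auto simp: pairs_def)
  next
    fix z assume "z \<in> pairs S"
    then obtain i j where z: "z = (i, j)" "i \<in> S" "j \<in> S" "i < j"
      by (auto simp: pairs_def)
    from z(2,3) have "i \<in> enum S ` {..<?n}" "j \<in> enum S ` {..<?n}"
      by (simp_all only: bij_betw_imp_surj_on[OF bij])
    then obtain p q where pq: "i = enum S p" "j = enum S q" "p < ?n" "q < ?n"
      by auto
    have "p < q"
    proof (rule ccontr)
      assume "\<not> p < q"
      then have "q < p \<or> q = p" by auto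
      then show False
        using mono[of q p] pq z(4) by auto
    qed
    then show "z \<in> (\<lambda>(q, p). (enum S p, enum S q)) ` ?D"
      using pq z(1) by (auto intro!: image_eqI[of _ _ "(q, p)"])
  qed
  from prod.reindex_bij_betw[OF this, of "\<lambda>(i, j). f i j"]
  have "(\<Prod>(i, j)\<in>pairs S. f i j) = (\<Prod>(q, p)\<in>?D. f (enum S p) (enum S q))"
    by (simp add: case_prod_unfold)
  also have "\<dots> = (\<Prod>q<?n. \<Prod>p<q. f (enum S p) (enum S q))"
    by (rule prod.Sigma[symmetric]) auto
  finally show ?thesis .
qed

text \<open>A pair lies within \<open>I\<close>, lies within \<open>U - I\<close>, or joins the two;
  by symmetry of \<open>h\<close> a joining pair may be listed with its element of \<open>I\<close>
  first.\<close>

lemma prod_pairs_split: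
  fixes h :: "nat \<Rightarrow> nat \<Rightarrow> 'a::comm_monoid_mult"
  assumes "finite U" "I \<subseteq> U" and sym: "\<And>i j. h i j = h j i"
  shows "(\<Prod>(i, j)\<in>pairs U. h i j)
    = (\<Prod>(i, j)\<in>pairs I. h i j) * (\<Prod>(i, j)\<in>pairs (U - I). h i j) * (\<Prod>i\<in>I. \<Prod>j\<in>U - I. h i j)"
proof -
  define M where "M = {(i, j). i \<in> U \<and> j \<in> U \<and> i < j \<and> (i \<in> I \<longleftrightarrow> j \<notin> I)}"
  have fin: "finite (pairs I)" "finite (pairs (U - I))" "finite M" "finite I"
    using assms(1,2) finite_subset[of I U] finite_subset[of M "U \<times> U"]
    by (auto simp: M_def intro: finite_pairs)
  have "pairs U = (pairs I \<union> pairs (U - I)) \<union> M"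
    using assms(2) by (auto simp: pairs_def M_def)
  moreover have "(pairs I \<union> pairs (U - I)) \<inter> M = {}" "pairs I \<inter> pairs (U - I) = {}"
    by (auto simp: pairs_def M_def)
  ultimately have "(\<Prod>(i, j)\<in>pairs U. h i j)
      = (\<Prod>(i, j)\<in>pairs I. h i j) * (\<Prod>(i, j)\<in>pairs (U - I). h i j) * (\<Prod>(i, j)\<in>M. h i j)"
    using fin by (simp add: prod.union_disjoint)
  also have "(\<Prod>(i, j)\<in>M. h i j) = (\<Prod>(i, j)\<in>I \<times> (U - I). h i j)"
    by (rule prod.reindex_bij_witness[where i = "\<lambda>(i, j). if i < j then (i, j) else (j, i)"
          and j = "\<lambda>(i, j). if i \<in> I then (i, j) else (j, i)"])
      (use assms(2) in \<open>auto simp: M_def sym not_less order.order_iff_strict split: if_splits\<close>)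
  also have "\<dots> = (\<Prod>i\<in>I. \<Prod>j\<in>U - I. h i j)"
    using fin(4) assms(1) by (simp add: prod.cartesian_product)
  finally show ?thesis .
qed

text \<open>Of the product over all pairs, the factors joining \<open>I\<close> to its complement
  clear the denominators of the determinant, and the others make up the two factors
  \<open>J\<close>.\<close>

lemma det_cauchy_half_subset:
  fixes a b c :: "'a::field"
  assumes nz: "\<And>i j. 1 \<le> i \<Longrightarrow> i < j \<Longrightarrow> j \<le> 2*n \<Longrightarrow> bilin a b c (x i) (x j) \<noteq> 0"
    and I: "I \<subseteq> {1..2*n}" "card I = n"
  shows "det (mat n n (\<lambda>(i, j). 1 / bilin a b c (x (enum I i)) (x (enum ({1..2*n} - I) j))))
      * (\<Prod>(i, j)\<in>pairs {1..2*n}. bilin a b c (x i) (x j))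
    = (b\<^sup>2 - a * c) ^ (n choose 2) * Delta x I * Delta x ({1..2*n} - I)
      * J a b c x I * J a b c x ({1..2*n} - I)"
proof -
  let ?I' = "{1..2*n} - I"
  let ?B = "\<lambda>i j. bilin a b c (x i) (x j)"
  note half = half_subset[OF I]
  have Delta: "Delta x S = (\<Prod>q<card S. \<Prod>p<q. x (enum S p) - x (enum S q))" if "finite S" for S
    using prod_pairs_enum[OF that, of "\<lambda>i j. x i - x j"] by (simp add: Delta_def pairs_def)
  have J: "J a b c x S = (\<Prod>(i, j)\<in>pairs S. ?B i j)" for S
    by (simp add: J_def pairs_def bilin_def)
  have nz': "?B (enum I i) (enum ?I' j) \<noteq> 0" if "i < n" "j < n" for i j
  proof -
    have *: "enum I i \<in> I" "enum ?I' j \<in> ?I'"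
      using that bij_betwE[OF half(4)] bij_betwE[OF half(5)] by auto
    then have "enum I i \<noteq> enum ?I' j" by auto
    then consider "enum I i < enum ?I' j" | "enum ?I' j < enum I i" by linarith
    then show ?thesis
    proof cases
      case 1
      then show ?thesis using * I(1) by (intro nz) auto
    next
      case 2
      then show ?thesis using * I(1) by (subst bilin_commute) (intro nz; auto)
    qed
  qed
  have "(\<Prod>i<n. \<Prod>j<n. ?B (enum I i) (enum ?I' j)) = (\<Prod>i<n. \<Prod>j\<in>?I'. ?B (enum I i) j)"
    by (intro prod.cong[OF refl] prod.reindex_bij_betw[OF half(5)])
  also have "\<dots> = (\<Prod>i\<in>I. \<Prod>j\<in>?I'. ?B i j)"
    by (rule prod.reindex_bij_betw[OF half(4)])
  finally have mixed: "(\<Prod>i<n. \<Prod>j<n. ?B (enum I i) (enum ?I' j)) = (\<Prod>i\<in>I. \<Prod>j\<in>?I'. ?B i j)" .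
  have "(\<Prod>(i, j)\<in>pairs {1..2*n}. ?B i j) = J a b c x I * J a b c x ?I' * (\<Prod>i\<in>I. \<Prod>j\<in>?I'. ?B i j)"
    unfolding J by (rule prod_pairs_split[OF _ I(1)]) (simp_all add: bilin_commute)
  moreover have "det (mat n n (\<lambda>(i, j). 1 / ?B (enum I i) (enum ?I' j))) * (\<Prod>i\<in>I. \<Prod>j\<in>?I'. ?B i j)
      = (b\<^sup>2 - a * c) ^ (n choose 2) * Delta x I * Delta x ?I'"
    using det_cauchy_bilin[of n a b c "\<lambda>k. x (enum I k)" "\<lambda>k. x (enum ?I' k)", OF nz']
    unfolding mixed Delta[OF half(1)] Delta[OF half(2)] I(2) half(3) by simp
  ultimately show ?thesis
    by (simp add: mult_ac)
qed

section \<open>Comparison of signs, and folding the sum by complementation\<close>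

lemma choose_two_Suc: "Suc n choose 2 = n + (n choose 2)"
  by (simp add: numeral_2_eq_2)

text \<open>The permutation contributes the exponent \<open>\<Sum>I + n\<close> and the change from
  \<open>b\<^sup>2 - a * c\<close> to \<open>a * c - b\<^sup>2\<close> contributes
  \<open>n choose 2\<close>. Together they exceed \<open>\<Sum>I\<close> by
  \<open>Suc n choose 2\<close>, and modulo 2 this may as well be subtracted.\<close>

lemma subset_perm_sign_exponent:
  fixes a b c :: "'a::comm_ring_1"
  assumes "I \<subseteq> {1..2*n}" "card I = n"
  shows "of_int (sign (subset_perm n I)) * (b\<^sup>2 - a * c) ^ (n choose 2)
    = (a * c - b\<^sup>2) ^ (n choose 2) * (- 1) ^ (\<Sum>I - (Suc n choose 2))"
proof -
  let ?C = "n + (n choose 2)"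
  obtain e where e: "\<Sum>I = ?C + e"
    using sum_half_subset_ge[OF assms] unfolding choose_two_Suc by (metis le_Suc_ex)
  have "(b\<^sup>2 - a * c) ^ (n choose 2) = (- 1) ^ (n choose 2) * (a * c - b\<^sup>2) ^ (n choose 2)"
    by (simp flip: power_mult_distrib)
  moreover have "(- 1 :: 'a) ^ (?C + e + n) * (- 1) ^ (n choose 2) = (- 1) ^ e"
    by (auto simp: minus_one_power_iff)
  ultimately show ?thesis
    unfolding sign_subset_perm[OF assms] choose_two_Suc e by (simp add: mult_ac flip: mult.assoc)
qed

text \<open>The factors \<open>Delta\<close> and \<open>J\<close> are only permuted, so the signs
  decide. The two subset sums add up to \<open>n * (2 * n + 1)\<close>, which has the parity of
  \<open>n\<close>, and the offset is subtracted twice.\<close>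

lemma subset_weight_compl:
  fixes a b c :: "'a::comm_ring_1"
  assumes I: "I \<subseteq> {1..2*n}" "card I = n"
  shows "subset_weight n a b c x ({1..2*n} - I) = (- 1) ^ n * subset_weight n a b c x I"
proof -
  let ?I' = "{1..2*n} - I"
  let ?C = "n + 1 choose 2"
  have "?C \<le> \<Sum>I" "?C \<le> \<Sum>?I'"
    using sum_half_subset_ge[OF I] sum_half_subset_ge[OF Diff_subset half_subset(3)[OF I]] by simp_all
  then obtain e f where e: "\<Sum>I = ?C + e" and f: "\<Sum>?I' = ?C + f"
    by (metis le_Suc_ex)
  have "\<Sum>{1..2*n} = n * (2 * n + 1)"
    using gauss_sum_from_Suc_0[of "2 * n", where 'a = nat] by simp
  moreover have "\<Sum>{1..2*n} = \<Sum>I + \<Sum>?I'"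
    using sum.subset_diff[OF I(1), of "\<lambda>i. i"] by simp
  ultimately have "even (?C + e + (?C + f)) \<longleftrightarrow> even (n * (2 * n + 1))"
    using e f by simp
  then have "even (e + f + n)"
    by auto
  then have "(- 1 :: 'a) ^ f = (- 1) ^ n * (- 1) ^ e"
    by (auto simp: minus_one_power_iff)
  moreover have "{1..2*n} - ?I' = I"
    using I(1) by auto
  ultimately show ?thesis
    unfolding subset_weight_def e f by (simp add: mult_ac)
qed

text \<open>Complementation exchanges the subsets that satisfy the condition on minima with those
  that do not. With \<open>n \<ge> 1\<close> both halves are nonempty, so the minima are elements of
  disjoint sets and differ.\<close>

lemma sum_half_subsets_fold:
  fixes y :: "nat \<Rightarrow> 'a::comm_ring_1"
  assumes "n \<ge> 1"
  shows "(\<Sum>I\<in>half_subsets n. subset_weight n a b c x I * (\<Prod>i\<in>I. y i))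
    = (\<Sum>I | I \<in> half_subsets n \<and> Min I < Min ({1..2*n} - I).
        subset_weight n a b c x I * ((\<Prod>i\<in>I. y i) + (- 1) ^ n * (\<Prod>i\<in>{1..2*n} - I. y i)))"
proof -
  let ?U = "{1..2*n}"
  let ?f = "\<lambda>I. subset_weight n a b c x I * (\<Prod>i\<in>I. y i)"
  let ?H1 = "{I. I \<in> half_subsets n \<and> Min I < Min (?U - I)}"
  let ?H2 = "{I. I \<in> half_subsets n \<and> \<not> Min I < Min (?U - I)}"
  have compl: "?U - I \<in> half_subsets n" "?U - (?U - I) = I" "Min I \<noteq> Min (?U - I)"
    if "I \<in> half_subsets n" for I
  proof -
    have I: "I \<subseteq> ?U" "card I = n"
      using that by (auto simp: half_subsets_def)
    show "?U - I \<in> half_subsets n" "?U - (?U - I) = I"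
      using half_subset(3)[OF I] I(1) by (auto simp: half_subsets_def)
    have "I \<noteq> {}" "?U - I \<noteq> {}"
      using assms I(2) half_subset(3)[OF I] by (metis card.empty not_one_le_zero)+
    then have "Min I \<in> I" "Min (?U - I) \<in> ?U - I"
      using Min_in[OF half_subset(1)[OF I]] Min_in[OF half_subset(2)[OF I]] by blast+
    then show "Min I \<noteq> Min (?U - I)"
      by auto
  qed
  have "sum ?f (half_subsets n) = sum ?f (?H1 \<union> ?H2)"
    by (rule sum.cong) auto
  also have "\<dots> = sum ?f ?H1 + sum ?f ?H2"
    by (rule sum.union_disjoint) (auto intro: finite_subset[OF _ finite_half_subsets])
  also have "sum ?f ?H2 = (\<Sum>I\<in>?H1. ?f (?U - I))"
    by (rule sum.reindex_bij_witness[where i = "\<lambda>I. ?U - I" and j = "\<lambda>I. ?U - I"])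
      (use compl in \<open>simp_all, metis linorder_neqE_nat\<close>)
  also have "(\<Sum>I\<in>?H1. ?f I) + (\<Sum>I\<in>?H1. ?f (?U - I))
      = (\<Sum>I\<in>?H1. subset_weight n a b c x I * ((\<Prod>i\<in>I. y i) + (- 1) ^ n * (\<Prod>i\<in>?U - I. y i)))"
    unfolding sum.distrib[symmetric]
  proof (rule sum.cong[OF refl])
    fix I assume "I \<in> ?H1"
    then have "subset_weight n a b c x (?U - I) = (- 1) ^ n * subset_weight n a b c x I"
      by (intro subset_weight_compl) (auto simp: half_subsets_def)
    then show "?f I + ?f (?U - I)
        = subset_weight n a b c x I * ((\<Prod>i\<in>I. y i) + (- 1) ^ n * (\<Prod>i\<in>?U - I. y i))"
      by (simp only: distrib_left mult_ac)
  qed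
  finally show ?thesis .
qed

text \<open>The variables are arbitrary field elements with nonvanishing denominators, which
  includes indeterminates in a field of rational functions; \<open>i_1 < j_1\<close> becomes a
  comparison of minima. The final claim asks for \<open>n \<ge> 2\<close> because
  \<open>1 choose 2 = 0\<close>: for \<open>n = 1\<close> the power of
  \<open>a * c - b\<^sup>2\<close> is 1, and the Pfaffian is a single entry, nonzero whenever
  \<open>y 1\<close> and \<open>y 2\<close> differ.\<close>

theorem theorem7p1:
  fixes n :: nat and a b c :: "'a::field" and x y :: "nat \<Rightarrow> 'a"
  assumes "n \<ge> 1"
    and "\<And>i j. 1 \<le> i \<Longrightarrow> i < j \<Longrightarrow> j \<le> 2*n \<Longrightarrow> a + b * (x i + x j) + c * x i * x j \<noteq> 0"
  shows
    "pfaffian n (\<lambda>i j. (y i - y j) / (a + b * (x i + x j) + c * x i * x j))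
         * (\<Prod>(i, j)\<in>{(i, j). 1 \<le> i \<and> i < j \<and> j \<le> 2*n}. a + b * (x i + x j) + c * x i * x j)
       = (a * c - b^2) ^ (n choose 2)
         * (\<Sum>I | I \<subseteq> {1..2*n} \<and> card I = n. subset_weight n a b c x I * (\<Prod>i\<in>I. y i))
     \<and> (a * c - b^2) ^ (n choose 2)
         * (\<Sum>I | I \<subseteq> {1..2*n} \<and> card I = n. subset_weight n a b c x I * (\<Prod>i\<in>I. y i))
       = (a * c - b^2) ^ (n choose 2)
         * (\<Sum>I | I \<subseteq> {1..2*n} \<and> card I = n \<and> Min I < Min ({1..2*n} - I).
              subset_weight n a b c x I
                * ((\<Prod>i\<in>I. y i) + (- 1) ^ n * (\<Prod>i\<in>{1..2*n} - I. y i)))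
     \<and> (n \<ge> 2 \<longrightarrow> a * c = b^2 \<longrightarrow>
         pfaffian n (\<lambda>i j. (y i - y j) / (a + b * (x i + x j) + c * x i * x j)) = 0)"
proof -
  let ?B = "\<lambda>i j. bilin a b c (x i) (x j)"
  let ?P = "pfaffian n (\<lambda>i j. (y i - y j) * (1 / ?B i j))"
  let ?D = "(a * c - b\<^sup>2) ^ (n choose 2)"
  have P_eq: "pfaffian n (\<lambda>i j. (y i - y j) / (a + b * (x i + x j) + c * x i * x j)) = ?P"
    by (simp add: bilin_def)
  have pairs_eq: "{(i, j). 1 \<le> i \<and> i < j \<and> j \<le> 2*n} = pairs {1..2*n}"
    by (auto simp: pairs_def)
  have nz: "?B i j \<noteq> 0" if "1 \<le> i" "i < j" "j \<le> 2*n" for i j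
    unfolding bilin_def by (rule assms(2)[OF that])
  have half: "{I. I \<subseteq> {1..2*n} \<and> card I = n} = half_subsets n"
    by (simp add: half_subsets_def)
  have main: "?P * (\<Prod>(i, j)\<in>pairs {1..2*n}. ?B i j)
      = ?D * (\<Sum>I\<in>half_subsets n. subset_weight n a b c x I * (\<Prod>i\<in>I. y i))"
  proof -
    have "?P * (\<Prod>(i, j)\<in>pairs {1..2*n}. ?B i j)
        = (\<Sum>I\<in>half_subsets n. of_int (sign (subset_perm n I)) * (\<Prod>i\<in>I. y i)
            * det (mat n n (\<lambda>(i, j). 1 / ?B (enum I i) (enum ({1..2*n} - I) j)))
            * (\<Prod>(i, j)\<in>pairs {1..2*n}. ?B i j))"
      by (subst pfaffian_eq_sum_det) (simp_all add: bilin_commute sum_distrib_right)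
    also have "\<dots> = (\<Sum>I\<in>half_subsets n. ?D * (subset_weight n a b c x I * (\<Prod>i\<in>I. y i)))"
    proof (rule sum.cong[OF refl])
      fix I assume "I \<in> half_subsets n"
      then have I: "I \<subseteq> {1..2*n}" "card I = n"
        by (auto simp: half_subsets_def)
      define E where "E = Delta x I * Delta x ({1..2*n} - I) * J a b c x I * J a b c x ({1..2*n} - I)"
      have det: "det (mat n n (\<lambda>(i, j). 1 / ?B (enum I i) (enum ({1..2*n} - I) j)))
          * (\<Prod>(i, j)\<in>pairs {1..2*n}. ?B i j) = (b\<^sup>2 - a * c) ^ (n choose 2) * E"
        using det_cauchy_half_subset[of n a b c x, OF nz I] by (simp only: E_def mult.assoc)
      have "of_int (sign (subset_perm n I)) * (\<Prod>i\<in>I. y i)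
            * det (mat n n (\<lambda>(i, j). 1 / ?B (enum I i) (enum ({1..2*n} - I) j)))
            * (\<Prod>(i, j)\<in>pairs {1..2*n}. ?B i j)
          = (of_int (sign (subset_perm n I)) * (b\<^sup>2 - a * c) ^ (n choose 2)) * E * (\<Prod>i\<in>I. y i)"
        unfolding mult.assoc det by (simp only: mult_ac)
      also have "\<dots> = ?D * (subset_weight n a b c x I * (\<Prod>i\<in>I. y i))"
        unfolding subset_perm_sign_exponent[OF I] by (simp add: subset_weight_def E_def mult.assoc)
      finally show "of_int (sign (subset_perm n I)) * (\<Prod>i\<in>I. y i)
            * det (mat n n (\<lambda>(i, j). 1 / ?B (enum I i) (enum ({1..2*n} - I) j)))
            * (\<Prod>(i, j)\<in>pairs {1..2*n}. ?B i j)
          = ?D * (subset_weight n a b c x I * (\<Prod>i\<in>I. y i))" .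
    qed
    finally show ?thesis
      by (simp only: sum_distrib_left)
  qed
  have vanish: "?P = 0" if "n \<ge> 2" "a * c = b\<^sup>2"
  proof -
    have "n choose 2 > 0"
      using that(1) by (simp add: zero_less_binomial_iff)
    then have "?P * (\<Prod>(i, j)\<in>pairs {1..2*n}. ?B i j) = 0"
      unfolding main using that(2) by simp
    moreover have "(\<Prod>(i, j)\<in>pairs {1..2*n}. ?B i j) \<noteq> 0"
      unfolding prod_zero_iff[OF finite_pairs[OF finite_atLeastAtMost]]
      using nz by (auto simp: pairs_def)
    ultimately show ?thesis
      by simp
  qed
  have fold: "{I. I \<subseteq> {1..2*n} \<and> card I = n \<and> Min I < Min ({1..2*n} - I)}
      = {I. I \<in> half_subsets n \<and> Min I < Min ({1..2*n} - I)}"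
    by (simp add: half_subsets_def)
  show ?thesis
    unfolding P_eq pairs_eq half fold sum_half_subsets_fold[OF assms(1), symmetric]
    using main vanish by (simp add: bilin_def)
qed

end
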